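(* Let $G \in \Gamma_1$. Let $G'$ be a flower subgraph of $G$ with $|\mathcal{P}(G')| = |\mathcal{P}(G)|$ having the maximum number of petal mp-subgraphs of Type 2 among such flower subgraphs. Then $r(G) = n_1 + 2n_2$, where $n_1$ and $n_2$ are the numbers of petal mp-subgraphs of $G'$ of Type 1 and of Type 2, respectively.
   Context: All graphs are finite, simple and undirected. Monophonic convexity: $S \subseteq V(G)$ is monophonically convex if every vertex of every induced path joining two vertices of $S$ lies in $S$; $\langle S\rangle$ is the smallest such set containing $S$; $S$ is monophonically convexly independent if $v \notin \langle S-\{v\}\rangle$ for all $v \in S$; $r(G)$ is the maximum size of such a set. A clique separator of a connected graph is a clique whose removal disconnects it; a connected graph is prime if it has no clique separator; an mp-subgraph of $G$ is a maximal induced prime subgraph. For an mp-subgraph $M$, $\partial M$ is the set of vertices of $M$ lying in another mp-subgraph and $M^\circ = V(M)-\partial M$; $M$ is a petal mp-subgraph if $M^\circ \neq \varnothing$ and $\partial M$ is a clique. $\mathcal{P}(H)$ denotes the family of petal mp-subgraphs of $H$. Flower subgraphs: $G$ is one; if $G'$ is one and $M$ is a petal mp-subgraph of $G'$, then $G' - M^\circ$ is one. For a petal $M$ of $H$, $X \subseteq M^\circ$ is a stamen set for $M$ in $H$ if $|X|=1$ (Type 1); or $X=\{u_1,u_2\}$ with every vertex of $\partial M$ adjacent to $u_1$ and $u_2$ (Type 2); or $|X|\ge 2$ and $X\cup\partial M$ is a clique (Type 3). A petal mp-subgraph is said to be of Type 2 if it admits a stamen set of Type 2, and of Type 1 otherwise.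 $\Gamma_1$ is the class of graphs $G$ that are $K_4$-free and such that every mp-subgraph of $G$ containing a $K_3$ is isomorphic to $K_3$ (it contains bipartite, cactus and triangle-free graphs).
   Formalization: Added hypothesis: in every connected component of G containing a triangle, the petals of G' contribute at least 3 to n_1+2n_2. Without it the formula fails: K_3 has rank 3 but n_1+2n_2=2, and K_4 minus an edge has rank 3 but two Type 1 petals. *)

theory Defs
  imports Main "HOL.Hull"
begin

text \<open>
  A graph is a pair of a vertex set \<open>V\<close> and an adjacency relation \<open>E\<close>, where only the restriction
  of \<open>E\<close> to \<open>V\<close> matters. Hence the subgraph induced by \<open>W \<subseteq> V\<close> is the graph \<open>W, E\<close> with the same
  \<open>E\<close>, and all subgraphs below (mp-subgraphs, petals, flower subgraphs, components), being
  induced, are identified with their vertex sets. Cliques (possibly empty) are the sets \<open>C\<close> with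
  \<open>pairwise E C\<close>.
\<close>

definition simple_graph :: "'a set \<Rightarrow> ('a \<Rightarrow> 'a \<Rightarrow> bool) \<Rightarrow> bool" where
  "simple_graph V E \<longleftrightarrow> finite V \<and> symp_on V E \<and> irreflp_on V E"

definition induces_K :: "('a \<Rightarrow> 'a \<Rightarrow> bool) \<Rightarrow> nat \<Rightarrow> 'a set \<Rightarrow> bool" where
  "induces_K E n C \<longleftrightarrow> finite C \<and> card C = n \<and> pairwise E C"

definition contains_K :: "'a set \<Rightarrow> ('a \<Rightarrow> 'a \<Rightarrow> bool) \<Rightarrow> nat \<Rightarrow> bool" where
  "contains_K W E n \<longleftrightarrow> (\<exists>C\<subseteq>W. induces_K E n C)"


text \<open>Monophonic convexity.\<close>

text \<open>Any two vertices of the list are adjacent exactly if they are consecutive.\<close>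
definition induced_path :: "'a set \<Rightarrow> ('a \<Rightarrow> 'a \<Rightarrow> bool) \<Rightarrow> 'a list \<Rightarrow> bool" where
  "induced_path V E p \<longleftrightarrow> p \<noteq> [] \<and> distinct p \<and> set p \<subseteq> V \<and>
     (\<forall>i j. i < j \<and> j < length p \<longrightarrow> (E (p ! i) (p ! j) \<longleftrightarrow> j = Suc i))"

definition monophonically_convex :: "'a set \<Rightarrow> ('a \<Rightarrow> 'a \<Rightarrow> bool) \<Rightarrow> 'a set \<Rightarrow> bool" where
  "monophonically_convex V E S \<longleftrightarrow> S \<subseteq> V \<and>
     (\<forall>p. induced_path V E p \<and> hd p \<in> S \<and> last p \<in> S \<longrightarrow> set p \<subseteq> S)"

definition monophonically_independent :: "'a set \<Rightarrow> ('a \<Rightarrow> 'a \<Rightarrow> bool) \<Rightarrow> 'a set \<Rightarrow> bool" where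
  "monophonically_independent V E S \<longleftrightarrow> S \<subseteq> V \<and>
     (\<forall>v\<in>S. v \<notin> monophonically_convex V E hull (S - {v}))"

definition monophonic_rank :: "'a set \<Rightarrow> ('a \<Rightarrow> 'a \<Rightarrow> bool) \<Rightarrow> nat" where
  "monophonic_rank V E = Max {card S | S. monophonically_independent V E S}"


text \<open>Clique separators and mp-subgraphs.\<close>

text \<open>The empty graph counts as connected, so that removing all vertices of a complete graph does
  not disconnect it.\<close>
definition connected_graph :: "'a set \<Rightarrow> ('a \<Rightarrow> 'a \<Rightarrow> bool) \<Rightarrow> bool" where
  "connected_graph W E \<longleftrightarrow>
     (\<forall>u\<in>W. \<forall>v\<in>W. (\<lambda>x y. x \<in> W \<and> y \<in> W \<and> E x y)\<^sup>*\<^sup>* u v)"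

definition component :: "'a set \<Rightarrow> ('a \<Rightarrow> 'a \<Rightarrow> bool) \<Rightarrow> 'a set \<Rightarrow> bool" where
  "component W E C \<longleftrightarrow> C \<noteq> {} \<and> C \<subseteq> W \<and> connected_graph C E \<and>
     (\<forall>D. C \<subset> D \<and> D \<subseteq> W \<longrightarrow> \<not> connected_graph D E)"

definition clique_separator :: "'a set \<Rightarrow> ('a \<Rightarrow> 'a \<Rightarrow> bool) \<Rightarrow> 'a set \<Rightarrow> bool" where
  "clique_separator W E C \<longleftrightarrow> C \<subseteq> W \<and> pairwise E C \<and> \<not> connected_graph (W - C) E"

definition prime_graph :: "'a set \<Rightarrow> ('a \<Rightarrow> 'a \<Rightarrow> bool) \<Rightarrow> bool" where
  "prime_graph W E \<longleftrightarrow> connected_graph W E \<and> (\<nexists>C. clique_separator W E C)"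

definition mp_subgraph :: "'a set \<Rightarrow> ('a \<Rightarrow> 'a \<Rightarrow> bool) \<Rightarrow> 'a set \<Rightarrow> bool" where
  "mp_subgraph W E M \<longleftrightarrow> M \<subseteq> W \<and> prime_graph M E \<and>
     (\<forall>N. M \<subset> N \<and> N \<subseteq> W \<longrightarrow> \<not> prime_graph N E)"

definition mp_boundary :: "'a set \<Rightarrow> ('a \<Rightarrow> 'a \<Rightarrow> bool) \<Rightarrow> 'a set \<Rightarrow> 'a set" where
  "mp_boundary W E M = {v \<in> M. \<exists>N. mp_subgraph W E N \<and> N \<noteq> M \<and> v \<in> N}"

definition mp_interior :: "'a set \<Rightarrow> ('a \<Rightarrow> 'a \<Rightarrow> bool) \<Rightarrow> 'a set \<Rightarrow> 'a set" where
  "mp_interior W E M = M - mp_boundary W E M"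


text \<open>Petals and flower subgraphs.\<close>

definition petals :: "'a set \<Rightarrow> ('a \<Rightarrow> 'a \<Rightarrow> bool) \<Rightarrow> 'a set set" where
  "petals W E = {M. mp_subgraph W E M \<and> mp_interior W E M \<noteq> {} \<and> pairwise E (mp_boundary W E M)}"

inductive flower_subgraph :: "'a set \<Rightarrow> ('a \<Rightarrow> 'a \<Rightarrow> bool) \<Rightarrow> 'a set \<Rightarrow> bool"
  for V :: "'a set" and E :: "'a \<Rightarrow> 'a \<Rightarrow> bool" where
  refl: "flower_subgraph V E V"
| step: "flower_subgraph V E W \<Longrightarrow> M \<in> petals W E \<Longrightarrow> flower_subgraph V E (W - mp_interior W E M)"

definition stamen_set2 :: "'a set \<Rightarrow> ('a \<Rightarrow> 'a \<Rightarrow> bool) \<Rightarrow> 'a set \<Rightarrow> 'a set \<Rightarrow> bool" where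
  "stamen_set2 W E M X \<longleftrightarrow> X \<subseteq> mp_interior W E M \<and>
     (\<exists>u1 u2. u1 \<noteq> u2 \<and> X = {u1, u2} \<and> (\<forall>w\<in>mp_boundary W E M. E w u1 \<and> E w u2))"

definition petals2 :: "'a set \<Rightarrow> ('a \<Rightarrow> 'a \<Rightarrow> bool) \<Rightarrow> 'a set set" where
  "petals2 W E = {M \<in> petals W E. \<exists>X. stamen_set2 W E M X}"

definition petals1 :: "'a set \<Rightarrow> ('a \<Rightarrow> 'a \<Rightarrow> bool) \<Rightarrow> 'a set set" where
  "petals1 W E = petals W E - petals2 W E"

definition Gamma1 :: "'a set \<Rightarrow> ('a \<Rightarrow> 'a \<Rightarrow> bool) \<Rightarrow> bool" where
  "Gamma1 V E \<longleftrightarrow> \<not> contains_K V E 4 \<and>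
     (\<forall>M. mp_subgraph V E M \<and> contains_K M E 3 \<longrightarrow> induces_K E 3 M)"

text \<open>
  The rank of a graph is the sum of the ranks of its components, and a component containing a
  triangle has rank at least 3, since every clique is monophonically convexly independent. The
  following condition says that the petals of \<open>W\<close> lying in such a component \<open>C\<close> of \<open>V\<close> contribute
  at least 3 to \<open>n\<^sub>1 + 2n\<^sub>2\<close>. Without it the formula \<open>n\<^sub>1 + 2n\<^sub>2\<close> for the rank is wrong: \<open>K\<^sub>3\<close> has
  rank 3 but a single petal, and \<open>K\<^sub>4\<close> minus an edge has rank 3 but two petals, both of Type 1.
\<close>
definition triangles_accounted :: "'a set \<Rightarrow> ('a \<Rightarrow> 'a \<Rightarrow> bool) \<Rightarrow> 'a set \<Rightarrow> bool" where
  "triangles_accounted V E W \<longleftrightarrow> (\<forall>C. component V E C \<and> contains_K C E 3 \<longrightarrow>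
     3 \<le> card {M \<in> petals1 W E. M \<subseteq> C} + 2 * card {M \<in> petals2 W E. M \<subseteq> C})"

end

theory Submission
  imports Defs
begin

text \<open>
  A set \<open>T\<close> is convex iff the neighbourhood of every component of its complement is a clique, and a
  minimal set with a clique neighbourhood is, together with this neighbourhood, a petal.
  Consequently, if a convex \<open>T\<close> meets every petal interior, then each vertex \<open>s \<notin> T\<close> lies in the
  interior of a petal \<open>M\<close> such that \<open>\<partial>M\<close> and the part of \<open>T\<close> in \<open>M\<close> form a clique. Applied to the hulls of
  \<open>S - {s}\<close> for an independent \<open>S\<close> meeting all petal interiors, this shows that \<open>S\<close> consists of stamen
  sets, at most two vertices per petal unless \<open>S\<close> induces a triangle in a component. Discarding the
  petals missed by \<open>S\<close> reduces the general case to this one, for some flower subgraph \<open>H\<close>.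

  It remains to compare \<open>H\<close> with flower subgraphs that have as many petals as \<open>V\<close>. Behind each petal
  \<open>Q\<close> of \<open>H\<close> there is at least one petal of \<open>V\<close>. Every Type 2 petal \<open>Q\<close> with two or more petals behind it
  is paid for by these; the others are exposed by peeling off \<open>V\<close> just what lies behind them, which
  keeps the number of petals.
\<close>

subsection \<open>Prime graphs and petals\<close>

definition nbhd :: "('a \<Rightarrow> 'a \<Rightarrow> bool) \<Rightarrow> 'a set \<Rightarrow> 'a set \<Rightarrow> 'a set" where
  "nbhd E W C = {y \<in> W - C. \<exists>x\<in>C. E x y}"

lemma simple_graph_subset: "simple_graph V E \<Longrightarrow> W \<subseteq> V \<Longrightarrow> simple_graph W E"
  unfolding simple_graph_def
  by (meson finite_subset irreflp_on_subset symp_on_subset)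

lemma simple_graph_finite: "simple_graph V E \<Longrightarrow> finite V"
  by (simp add: simple_graph_def)

lemma simple_graph_sym: "simple_graph V E \<Longrightarrow> x \<in> V \<Longrightarrow> y \<in> V \<Longrightarrow> E x y \<Longrightarrow> E y x"
  by (auto simp: simple_graph_def symp_on_def)

text \<open>A set with empty neighbourhood absorbs every walk starting in it, and the set of
  vertices reachable from a given one has empty neighbourhood.\<close>

lemma connected_graph_iff:
  "connected_graph W E \<longleftrightarrow> (\<forall>A\<subseteq>W. A \<noteq> {} \<and> nbhd E W A = {} \<longrightarrow> A = W)"
proof -
  let ?R = "\<lambda>x y. x \<in> W \<and> y \<in> W \<and> E x y"
  have "A = W" if con: "connected_graph W E" and A: "A \<subseteq> W" "A \<noteq> {}" "nbhd E W A = {}" for A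
  proof -
    from A obtain a where a: "a \<in> A" by auto
    have "v \<in> A" if "v \<in> W" for v
    proof -
      have "?R\<^sup>*\<^sup>* a v" using con a A(1) that by (auto simp: connected_graph_def)
      then show ?thesis
        by (induction) (use a A in \<open>auto simp: nbhd_def\<close>)
    qed
    then show ?thesis using A(1) by auto
  qed
  moreover have "connected_graph W E"
    if *: "\<And>A. A \<subseteq> W \<Longrightarrow> A \<noteq> {} \<Longrightarrow> nbhd E W A = {} \<Longrightarrow> A = W"
    unfolding connected_graph_def
  proof (intro ballI)
    fix u v assume uv: "u \<in> W" "v \<in> W"
    let ?A = "{y \<in> W. ?R\<^sup>*\<^sup>* u y}"
    have "?A = W"
    proof (rule *)
      show "nbhd E W ?A = {}"
        by (auto simp: nbhd_def intro: rtranclp.rtrancl_into_rtrancl)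
    qed (use uv in auto)
    then show "?R\<^sup>*\<^sup>* u v" using uv by auto
  qed
  ultimately show ?thesis by blast
qed

text \<open>A clique \<open>nbhd E M A\<close> cuts \<open>A\<close> off from whatever lies beyond
  it. Conversely, if a clique \<open>Z\<close> separates \<open>M\<close>, a union \<open>A\<close>
  of some but not all components of \<open>M - Z\<close> has its neighbourhood inside
  \<open>Z\<close>.\<close>

lemma prime_graph_iff:
  "prime_graph M E \<longleftrightarrow>
     (\<forall>A\<subseteq>M. A \<noteq> {} \<and> pairwise E (nbhd E M A) \<longrightarrow> M \<subseteq> A \<union> nbhd E M A)"
proof -
  have P: "prime_graph M E \<longleftrightarrow> (\<forall>Z\<subseteq>M. pairwise E Z \<longrightarrow> connected_graph (M - Z) E)"
  proof
    assume "prime_graph M E"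
    then show "\<forall>Z\<subseteq>M. pairwise E Z \<longrightarrow> connected_graph (M - Z) E"
      by (auto simp: prime_graph_def clique_separator_def)
  next
    assume *: "\<forall>Z\<subseteq>M. pairwise E Z \<longrightarrow> connected_graph (M - Z) E"
    then have "connected_graph M E" by (metis Diff_empty empty_subsetI pairwise_empty)
    with * show "prime_graph M E" unfolding prime_graph_def clique_separator_def by blast
  qed
  show ?thesis
  proof
    assume pr: "prime_graph M E"
    show "\<forall>A\<subseteq>M. A \<noteq> {} \<and> pairwise E (nbhd E M A) \<longrightarrow> M \<subseteq> A \<union> nbhd E M A"
    proof (intro allI impI, elim conjE)
      fix A assume A: "A \<subseteq> M" "A \<noteq> {}" "pairwise E (nbhd E M A)"
      have "connected_graph (M - nbhd E M A) E"
        using P pr A(3) by (auto simp: nbhd_def)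
      moreover have "A \<subseteq> M - nbhd E M A" "nbhd E (M - nbhd E M A) A = {}"
        using A(1) by (auto simp: nbhd_def)
      ultimately have "A = M - nbhd E M A" using A(2) by (auto simp: connected_graph_iff)
      then show "M \<subseteq> A \<union> nbhd E M A" by auto
    qed
  next
    assume *: "\<forall>A\<subseteq>M. A \<noteq> {} \<and> pairwise E (nbhd E M A) \<longrightarrow> M \<subseteq> A \<union> nbhd E M A"
    show "prime_graph M E"
      unfolding P connected_graph_iff
    proof (intro allI impI, elim conjE)
      fix Z A assume Z: "Z \<subseteq> M" "pairwise E Z" and A: "A \<subseteq> M - Z" "A \<noteq> {}" "nbhd E (M - Z) A = {}"
      have sub: "nbhd E M A \<subseteq> Z" using A by (auto simp: nbhd_def)
      have "pairwise E (nbhd E M A)" using Z(2) sub by (rule pairwise_subset)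
      then have "M \<subseteq> A \<union> nbhd E M A" using * A by blast
      then show "A = M - Z" using sub A by blast
    qed
  qed
qed

lemma prime_graph_clique: "pairwise E K \<Longrightarrow> prime_graph K E"
  by (fastforce simp: prime_graph_iff nbhd_def pairwise_def)

text \<open>The trace \<open>N \<inter> C\<close> has its neighbourhood in \<open>N\<close> inside
  the clique \<open>B\<close>, and a prime \<open>N\<close> has nothing beyond such a
  neighbourhood.\<close>

lemma prime_graph_side:
  assumes "prime_graph N E" "N \<subseteq> W" "N \<inter> C \<noteq> {}" "pairwise E B" "nbhd E W C \<subseteq> B"
  shows "N \<subseteq> C \<union> B"
proof -
  have "nbhd E N (N \<inter> C) \<subseteq> B" using assms(2,5) by (auto simp: nbhd_def)
  moreover from this have "pairwise E (nbhd E N (N \<inter> C))" by (rule pairwise_subset[OF assms(4)])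
  then have "N \<subseteq> (N \<inter> C) \<union> nbhd E N (N \<inter> C)"
    using assms(1,3) by (auto simp: prime_graph_iff)
  ultimately show ?thesis by blast
qed

lemma mp_subgraph_prime: "mp_subgraph W E M \<Longrightarrow> prime_graph M E"
  and mp_subgraph_subset: "mp_subgraph W E M \<Longrightarrow> M \<subseteq> W"
  and mp_subgraph_maximal: "mp_subgraph W E M \<Longrightarrow> prime_graph N E \<Longrightarrow> N \<subseteq> W \<Longrightarrow> M \<subseteq> N \<Longrightarrow> N = M"
  by (auto simp: mp_subgraph_def)

lemma prime_graph_in_mp_subgraph:
  assumes "finite W" "prime_graph P E" "P \<subseteq> W"
  obtains M where "mp_subgraph W E M" "P \<subseteq> M"
proof -
  let ?F = "{N. N \<subseteq> W \<and> prime_graph N E}"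
  have "finite ?F" using assms(1) by auto
  moreover have "P \<in> ?F" using assms by auto
  ultimately have "\<exists>M\<in>?F. P \<subseteq> M \<and> (\<forall>N\<in>?F. M \<subseteq> N \<longrightarrow> M = N)"
    by (rule finite_has_maximal2)
  then obtain M where "M \<in> ?F" "P \<subseteq> M" "\<forall>N\<in>?F. M \<subseteq> N \<longrightarrow> M = N" by blast
  then have "mp_subgraph W E M" by (auto simp: mp_subgraph_def)
  then show thesis using \<open>P \<subseteq> M\<close> that by blast
qed

lemma mp_boundary_subset: "mp_boundary W E M \<subseteq> M"
  by (auto simp: mp_boundary_def)

lemma mp_interior_subset: "mp_interior W E M \<subseteq> M"
  by (auto simp: mp_interior_def)

lemma mp_decomp: "M = mp_interior W E M \<union> mp_boundary W E M"
  by (auto simp: mp_interior_def mp_boundary_def)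

lemma mp_interior_unique:
  "x \<in> mp_interior W E M \<Longrightarrow> mp_subgraph W E N \<Longrightarrow> x \<in> N \<Longrightarrow> N = M"
  by (auto simp: mp_interior_def mp_boundary_def)

text \<open>An mp-subgraph extending \<open>P\<close> contains the interior vertex \<open>x\<close>,
  so it can only be \<open>M\<close>. Applied to edges, to attachment cliques and to petals.\<close>

lemma mp_interior_prime:
  assumes "finite W" "x \<in> mp_interior W E M" "prime_graph P E" "P \<subseteq> W" "x \<in> P"
  shows "P \<subseteq> M"
proof -
  obtain N where "mp_subgraph W E N" "P \<subseteq> N"
    using prime_graph_in_mp_subgraph[OF assms(1,3,4)] by blast
  then show ?thesis using mp_interior_unique[OF assms(2)] assms(5) by blast
qed

lemma mp_interior_edge:
  assumes "simple_graph W E" "x \<in> mp_interior W E M" "mp_subgraph W E M" "y \<in> W" "E x y \<or> E y x"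
  shows "y \<in> M"
proof -
  have x: "x \<in> W" using assms(2) mp_subgraph_subset[OF assms(3)] by (auto simp: mp_interior_def)
  have "E x y" "E y x"
    using assms(5) simple_graph_sym[OF assms(1) x assms(4)] simple_graph_sym[OF assms(1) assms(4) x] by blast+
  then have "prime_graph {x, y} E" by (intro prime_graph_clique) (auto simp: pairwise_insert)
  then have "{x, y} \<subseteq> M"
    using assms(4) x by (intro mp_interior_prime[OF simple_graph_finite[OF assms(1)] assms(2)]) auto
  then show ?thesis by simp
qed

lemma nbhd_mp_interior:
  assumes "simple_graph W E" "mp_subgraph W E M"
  shows "nbhd E W (mp_interior W E M) \<subseteq> mp_boundary W E M"
proof
  fix y assume "y \<in> nbhd E W (mp_interior W E M)"
  then obtain x where x: "y \<in> W" "y \<notin> mp_interior W E M" "x \<in> mp_interior W E M" "E x y"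
    by (auto simp: nbhd_def)
  then show "y \<in> mp_boundary W E M"
    using mp_interior_edge[OF assms(1) \<open>x \<in> mp_interior W E M\<close> assms(2)] x by (simp add: mp_interior_def)
qed

lemma petals_mp: "M \<in> petals W E \<Longrightarrow> mp_subgraph W E M"
  and petals_interior: "M \<in> petals W E \<Longrightarrow> mp_interior W E M \<noteq> {}"
  and petals_boundary: "M \<in> petals W E \<Longrightarrow> pairwise E (mp_boundary W E M)"
  by (auto simp: petals_def)

lemma petals_subset: "M \<in> petals W E \<Longrightarrow> M \<subseteq> W"
  by (rule mp_subgraph_subset[OF petals_mp])

lemma petals_prime: "M \<in> petals W E \<Longrightarrow> prime_graph M E"
  by (rule mp_subgraph_prime[OF petals_mp])

lemma finite_petals: "finite W \<Longrightarrow> finite (petals W E)"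
  by (rule finite_subset[of _ "Pow W"]) (auto dest: petals_subset)

lemma petals2_subset: "petals2 W E \<subseteq> petals W E"
  by (auto simp: petals2_def)

text \<open>By \<open>prime_graph_side\<close> a prime set meeting \<open>C\<close> stays within
  \<open>C \<union> B\<close>. This gives maximality and leaves no second mp-subgraph through a
  vertex of \<open>C\<close>.\<close>

lemma petalI:
  assumes "prime_graph (C \<union> B) E" "C \<union> B \<subseteq> W" "C \<noteq> {}" "C \<inter> B = {}" "pairwise E B" "nbhd E W C \<subseteq> B"
  shows "C \<union> B \<in> petals W E" "C \<subseteq> mp_interior W E (C \<union> B)" "mp_boundary W E (C \<union> B) \<subseteq> B"
proof -
  have mp: "mp_subgraph W E (C \<union> B)"
    unfolding mp_subgraph_def
    using assms prime_graph_side[of _ E W C B] by blast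
  have *: "N = C \<union> B" if "mp_subgraph W E N" "v \<in> N" "v \<in> C" for N v
  proof -
    have "N \<subseteq> C \<union> B"
      using that assms(5,6) mp_subgraph_prime[OF that(1)] mp_subgraph_subset[OF that(1)]
      by (intro prime_graph_side[of _ E W]) auto
    then show ?thesis using mp_subgraph_maximal[OF that(1) assms(1,2)] by simp
  qed
  show bd: "mp_boundary W E (C \<union> B) \<subseteq> B" using * by (fastforce simp: mp_boundary_def)
  show int: "C \<subseteq> mp_interior W E (C \<union> B)" using * by (fastforce simp: mp_interior_def mp_boundary_def)
  show "C \<union> B \<in> petals W E"
    using mp int assms(3) pairwise_subset[OF assms(5) bd] by (auto simp: petals_def)
qed

text \<open>Let \<open>C'\<close> be minimal among the nonempty subsets of \<open>C\<close> with a
  clique neighbourhood, and let \<open>M\<close> be \<open>C'\<close> with this neighbourhood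
  \<open>B\<close>. If a clique cut \<open>M\<close>, one side would miss \<open>B\<close>, as no
  two vertices of a clique can be separated; that side would lie in \<open>C'\<close> and contradict
  minimality.\<close>

lemma petal_behind:
  assumes "simple_graph W E" "C \<subseteq> W" "C \<noteq> {}" "pairwise E (nbhd E W C)"
  obtains M where "M \<in> petals W E" "M \<subseteq> C \<union> nbhd E W C" "M \<inter> C \<noteq> {}"
proof -
  let ?F = "{D. D \<subseteq> C \<and> D \<noteq> {} \<and> pairwise E (nbhd E W D)}"
  have fin: "finite ?F"
    using finite_subset[OF assms(2) simple_graph_finite[OF assms(1)]]
    by (intro finite_subset[of ?F "Pow C"]) auto
  have "C \<in> ?F" using assms by simp
  with fin have "\<exists>C'\<in>?F. C' \<subseteq> C \<and> (\<forall>D\<in>?F. D \<subseteq> C' \<longrightarrow> C' = D)"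
    by (rule finite_has_minimal2)
  then obtain C' where C': "C' \<subseteq> C" "C' \<noteq> {}" "pairwise E (nbhd E W C')"
    and min0: "\<forall>D\<in>?F. D \<subseteq> C' \<longrightarrow> C' = D"
    by (elim bexE conjE CollectE)
  have min: "C' = D" if "D \<subseteq> C'" "D \<noteq> {}" "pairwise E (nbhd E W D)" for D
  proof -
    have "D \<in> ?F" using that C'(1) by simp
    then show ?thesis using min0 that(1) by simp
  qed
  define B where "B = nbhd E W C'"
  define M where "M = C' \<union> B"
  have CB: "C' \<inter> B = {}" and BW: "B \<subseteq> W" by (auto simp: B_def nbhd_def)
  have MW: "M \<subseteq> W" using C' assms BW by (auto simp: M_def)
  have sep: False
    if D: "D \<subseteq> M" "D \<noteq> {}" "D \<inter> B = {}" and Z: "nbhd E M D \<subseteq> Z" "pairwise E Z" "\<not> M \<subseteq> D \<union> Z" for D Z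
  proof -
    have DC: "D \<subseteq> C'" using D by (auto simp: M_def)
    \<comment> \<open>Neighbours of \<open>C'\<close> never leave \<open>M\<close>, so passing from
      \<open>M\<close> to \<open>W\<close> adds no neighbours of \<open>D\<close>.\<close>
    have "nbhd E W D \<subseteq> nbhd E M D"
      using DC by (auto simp: nbhd_def M_def B_def)
    then have "nbhd E W D \<subseteq> Z" using Z(1) by simp
    then have "pairwise E (nbhd E W D)" by (rule pairwise_subset[OF Z(2)])
    then have "C' = D" using min DC D by blast
    then have "M \<subseteq> D \<union> nbhd E W D" by (auto simp: M_def B_def)
    then show False using Z \<open>nbhd E W D \<subseteq> Z\<close> by auto
  qed
  have "prime_graph M E"
    unfolding prime_graph_iff
  proof (intro allI impI, elim conjE)
    fix A assume A: "A \<subseteq> M" "A \<noteq> {}" "pairwise E (nbhd E M A)"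
    define Z where "Z = nbhd E M A"
    show "M \<subseteq> A \<union> nbhd E M A"
    proof (rule ccontr)
      assume n: "\<not> M \<subseteq> A \<union> nbhd E M A"
      \<comment> \<open>The other side of the cut. By symmetry of \<open>E\<close> its neighbourhood
        lies in \<open>Z\<close> too, so \<open>sep\<close> forces both sides to meet
        \<open>B\<close>, and two vertices of \<open>B\<close> are adjacent.\<close>
      define A2 where "A2 = M - A - Z"
      have AB: "A \<inter> B \<noteq> {}" using sep[of A Z] A n by (auto simp: Z_def)
      have "nbhd E M A2 \<subseteq> Z"
      proof
        fix y assume "y \<in> nbhd E M A2"
        then obtain x where "x \<in> A2" "y \<in> M" "y \<notin> A2" "E x y" by (auto simp: nbhd_def)
        moreover from this have "E y x" using MW simple_graph_sym[OF assms(1), of x y] by (auto simp: A2_def)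
        ultimately show "y \<in> Z" by (auto simp: A2_def Z_def nbhd_def)
      qed
      moreover have "A2 \<noteq> {}" "A2 \<subseteq> M" using n by (auto simp: A2_def Z_def)
      moreover have "\<not> M \<subseteq> A2 \<union> Z" using A by (auto simp: A2_def Z_def nbhd_def)
      ultimately have "A2 \<inter> B \<noteq> {}" using sep[of A2 Z] A(3) by (auto simp: Z_def)
      then obtain a b where ab: "a \<in> A" "a \<in> B" "b \<in> A2" "b \<in> B" using AB by auto
      then have "a \<noteq> b" by (auto simp: A2_def)
      then have "E a b" using ab C'(3) by (auto simp: B_def pairwise_def)
      then show False using ab by (auto simp: A2_def Z_def nbhd_def)
    qed
  qed
  then have "M \<in> petals W E"
    unfolding M_def using C' MW by (intro petalI) (auto simp: M_def B_def nbhd_def)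
  moreover have "M \<subseteq> C \<union> nbhd E W C"
    using C'(1) by (auto simp: M_def B_def nbhd_def)
  moreover have "M \<inter> C \<noteq> {}" using C' by (auto simp: M_def)
  ultimately show thesis by (rule that)
qed

text \<open>No vertex of \<open>D\<close> is adjacent to an interior vertex of \<open>M\<close>, so
  \<open>D\<close> is attached to \<open>M\<close> within the boundary, a clique, and
  \<open>petal_behind\<close> applies to \<open>D\<close>.\<close>

lemma petal_through:
  assumes "mp_subgraph W E M" "simple_graph W E" "D \<subseteq> W - M" "D \<noteq> {}" "pairwise E (mp_boundary W E M)"
    "nbhd E W D \<subseteq> M"
  obtains M' where "M' \<in> petals W E" "M' \<noteq> M" "M' \<subseteq> D \<union> mp_boundary W E M" "M' \<inter> D \<noteq> {}"
proof -
  have sub: "nbhd E W D \<subseteq> mp_boundary W E M"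
  proof
    fix z assume z: "z \<in> nbhd E W D"
    then obtain d where d: "d \<in> D" "E d z" "z \<in> W" by (auto simp: nbhd_def)
    have "z \<in> M" using z assms by auto
    moreover have "z \<notin> mp_interior W E M"
      using mp_interior_edge[OF assms(2) _ assms(1), of z d] d assms(3) by auto
    ultimately show "z \<in> mp_boundary W E M" by (auto simp: mp_interior_def)
  qed
  obtain M' where M': "M' \<in> petals W E" "M' \<subseteq> D \<union> nbhd E W D" "M' \<inter> D \<noteq> {}"
    using petal_behind[OF assms(2) _ assms(4) pairwise_subset[OF assms(5) sub]] assms(3) by blast
  then show thesis using that[of M'] sub assms(3) by blast
qed

subsection \<open>Convex sets\<close>

abbreviation walk :: "('a \<Rightarrow> 'a \<Rightarrow> bool) \<Rightarrow> 'a set \<Rightarrow> 'a \<Rightarrow> 'a \<Rightarrow> bool" where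
  "walk E W \<equiv> (\<lambda>x y. x \<in> W \<and> y \<in> W \<and> E x y)\<^sup>*\<^sup>*"

text \<open>By induction on the walk. The new vertex \<open>z\<close> is appended after cutting the
  path at its first vertex that equals \<open>z\<close> or is adjacent to it, which excludes
  chords.\<close>

lemma walk_induced_path:
  assumes "walk E W x y" "x \<in> W"
  obtains p where "induced_path W E p" "hd p = x" "last p = y"
proof -
  from assms(1) have "\<exists>p. induced_path W E p \<and> hd p = x \<and> last p = y"
  proof (induction rule: rtranclp_induct)
    case base
    show ?case by (intro exI[of _ "[x]"]) (use assms(2) in \<open>auto simp: induced_path_def\<close>)
  next
    case (step y z)
    then obtain p where p: "induced_path W E p" "hd p = x" "last p = y" by auto
    let ?P = "\<lambda>i. i < length p \<and> (p ! i = z \<or> E (p ! i) z)"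
    have "?P (length p - 1)" using p step(2) by (auto simp: induced_path_def last_conv_nth)
    then obtain i where i: "?P i" and min: "\<And>j. j < i \<Longrightarrow> \<not> ?P j"
      using exists_least_iff[of ?P] by metis
    define q where "q = take (Suc i) p"
    have lq: "length q = Suc i" and q: "\<And>j. j \<le> i \<Longrightarrow> q ! j = p ! j" using i by (auto simp: q_def)
    have hq: "hd q = x" using p by (simp add: q_def)
    have lastq: "last q = p ! i" using i by (simp add: q_def take_Suc_conv_app_nth)
    have qp: "induced_path W E q"
      using p(1) i set_take_subset[of "Suc i" p]
      unfolding induced_path_def q_def by auto
    show ?case
    proof (cases "p ! i = z")
      case True
      then show ?thesis using qp hq lastq by auto
    next
      case False
      then have Ez: "E (p ! i) z" using i by auto
      have zq: "z \<notin> set q"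
        using False min i q lq by (metis in_set_conv_nth less_Suc_eq_le nat_less_le less_trans)
      have "induced_path W E (q @ [z])"
        unfolding induced_path_def
      proof (intro conjI allI impI)
        fix j k assume jk: "j < k \<and> k < length (q @ [z])"
        show "E ((q @ [z]) ! j) ((q @ [z]) ! k) \<longleftrightarrow> k = Suc j"
        proof (cases "k < length q")
          case True
          then show ?thesis using jk qp by (auto simp: induced_path_def nth_append)
        next
          case False
          then have k: "k = Suc i" using jk lq by auto
          have "E (p ! j) z \<longleftrightarrow> j = i"
            using jk k Ez min[of j] i by (cases "j = i") auto
          then show ?thesis using jk k lq q by (auto simp: nth_append)
        qed
      qed (use qp zq step(2) in \<open>auto simp: induced_path_def\<close>)
      then show ?thesis using hq lq by (intro exI[of _ "q @ [z]"]) (auto simp: hd_append)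
    qed
  qed
  then show thesis using that by auto
qed

lemma induced_path_mono: "induced_path W E p \<Longrightarrow> W \<subseteq> V \<Longrightarrow> induced_path V E p"
  by (auto simp: induced_path_def)

lemma convexI:
  assumes "S \<subseteq> V"
    and "\<And>p. induced_path V E p \<Longrightarrow> hd p \<in> S \<Longrightarrow> last p \<in> S \<Longrightarrow> set p \<subseteq> S"
  shows "monophonically_convex V E S"
  using assms by (auto simp: monophonically_convex_def)

lemma convex_subset: "monophonically_convex V E T \<Longrightarrow> T \<subseteq> V"
  by (simp add: monophonically_convex_def)

lemma convex_path:
  "monophonically_convex V E T \<Longrightarrow> induced_path V E p \<Longrightarrow> hd p \<in> T \<Longrightarrow> last p \<in> T \<Longrightarrow> set p \<subseteq> T"
  by (auto simp: monophonically_convex_def)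

lemma convex_trans:
  assumes "monophonically_convex V E W" "monophonically_convex W E T"
  shows "monophonically_convex V E T"
proof (rule convexI)
  show "T \<subseteq> V" using assms by (auto simp: monophonically_convex_def)
  fix p assume p: "induced_path V E p" "hd p \<in> T" "last p \<in> T"
  have "T \<subseteq> W" using convex_subset[OF assms(2)] .
  then have "set p \<subseteq> W" using p convex_path[OF assms(1)] by blast
  then have "induced_path W E p" using p(1) by (simp add: induced_path_def)
  then show "set p \<subseteq> T" using p convex_path[OF assms(2)] by blast
qed

lemma convex_restrict:
  assumes "monophonically_convex V E T" "W \<subseteq> V"
  shows "monophonically_convex W E (T \<inter> W)"
proof (rule convexI)
  fix p assume p: "induced_path W E p" "hd p \<in> T \<inter> W" "last p \<in> T \<inter> W"
  have "set p \<subseteq> T" using convex_path[OF assms(1) induced_path_mono[OF p(1) assms(2)]] p by simp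
  then show "set p \<subseteq> T \<inter> W" using p(1) by (simp add: induced_path_def)
qed simp

lemma convex_Int:
  assumes "monophonically_convex V E S" "monophonically_convex V E T"
  shows "monophonically_convex V E (S \<inter> T)"
  using assms unfolding monophonically_convex_def by blast

lemma convex_whole: "monophonically_convex V E V"
  by (auto simp: monophonically_convex_def induced_path_def)

lemma convex_hull:
  assumes "S \<subseteq> V"
  shows "monophonically_convex V E (monophonically_convex V E hull S)"
proof -
  let ?H = "monophonically_convex V E hull S"
  have sub: "?H \<subseteq> T" if "monophonically_convex V E T" "S \<subseteq> T" for T
    using that by (intro hull_minimal)
  show ?thesis
    proof (rule convexI)
    show "?H \<subseteq> V" using sub[OF convex_whole assms] .
    fix p assume p: "induced_path V E p" "hd p \<in> ?H" "last p \<in> ?H"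
    have "set p \<subseteq> T" if T: "monophonically_convex V E T" "S \<subseteq> T" for T
      using convex_path[OF T(1) p(1)] sub[OF T] p(2,3) by blast
    then show "set p \<subseteq> ?H" unfolding hull_def by blast
  qed
qed

text \<open>An induced path entering \<open>C\<close> and leaving it again passes through two
  vertices of the neighbourhood of \<open>C\<close>; these are adjacent, which gives a
  chord.\<close>

lemma convex_diff:
  assumes "simple_graph V E" "C \<subseteq> V" "pairwise E (nbhd E V C)"
  shows "monophonically_convex V E (V - C)"
proof (rule convexI)
  fix p assume p: "induced_path V E p" "hd p \<in> V - C" "last p \<in> V - C"
  have pV: "\<And>i. i < length p \<Longrightarrow> p ! i \<in> V" and p0: "p \<noteq> []" and dist: "distinct p"
    using p(1) by (auto simp: induced_path_def)
  have ind: "\<And>i j. i < j \<Longrightarrow> j < length p \<Longrightarrow> E (p ! i) (p ! j) \<longleftrightarrow> j = Suc i"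
    using p(1) by (auto simp: induced_path_def)
  show "set p \<subseteq> V - C"
  proof (rule ccontr)
    assume "\<not> set p \<subseteq> V - C"
    then obtain k where k: "k < length p" "p ! k \<in> C" using pV by (auto simp: set_conv_nth)
    have a0: "p ! 0 \<notin> C" using p(2) p0 by (simp add: hd_conv_nth)
    \<comment> \<open>A step into \<open>C\<close> up to position \<open>k\<close>, and below a step
      out of \<open>C\<close> from \<open>k\<close> on. Since \<open>Suc i \<le> k \<le> j\<close>,
      the outer vertices \<open>p ! i\<close> and \<open>p ! Suc j\<close> are distinct and not
      consecutive.\<close>
    have "\<exists>i<k. p ! i \<notin> C \<and> p ! Suc i \<in> C"
    proof (rule ccontr)
      assume *: "\<not> ?thesis"
      have "i \<le> k \<Longrightarrow> p ! i \<notin> C" for i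
        by (induction i) (use * a0 in \<open>auto simp: Suc_le_eq\<close>)
      then show False using k by auto
    qed
    then obtain i where i: "i < k" "p ! i \<notin> C" "p ! Suc i \<in> C" by auto
    have aL: "p ! (length p - 1) \<notin> C" using p(3) p0 by (simp add: last_conv_nth)
    have "\<exists>j\<ge>k. Suc j < length p \<and> p ! j \<in> C \<and> p ! Suc j \<notin> C"
    proof (rule ccontr)
      assume *: "\<not> ?thesis"
      have "k + i < length p \<Longrightarrow> p ! (k + i) \<in> C" for i
        by (induction i) (use * k in auto)
      from this[of "length p - 1 - k"] show False using k aL p0 by auto
    qed
    then obtain j where j: "j \<ge> k" "Suc j < length p" "p ! j \<in> C" "p ! Suc j \<notin> C" by auto
    have "E (p ! i) (p ! Suc i)" "E (p ! j) (p ! Suc j)" using ind i j by auto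
    moreover have "E (p ! Suc i) (p ! i)"
      using simple_graph_sym[OF assms(1) pV pV \<open>E (p ! i) (p ! Suc i)\<close>] i k by simp
    ultimately have "p ! i \<in> nbhd E V C" "p ! Suc j \<in> nbhd E V C"
      using i j k pV by (auto simp: nbhd_def)
    moreover have "p ! i \<noteq> p ! Suc j" using i j dist by (auto simp: nth_eq_iff_index_eq)
    ultimately have "E (p ! i) (p ! Suc j)" using assms(3) by (auto simp: pairwise_def)
    then show False using ind[of i "Suc j"] i j by auto
  qed
qed auto

text \<open>In a simple graph, the component of \<open>x\<close> in \<open>W\<close> if
  \<open>x \<in> W\<close>. Otherwise it is \<open>{x}\<close>, since the reflexive closure does not
  check membership.\<close>

definition piece :: "('a \<Rightarrow> 'a \<Rightarrow> bool) \<Rightarrow> 'a set \<Rightarrow> 'a \<Rightarrow> 'a set" where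
  "piece E W x = {y. walk E W x y}"

lemma piece_self: "x \<in> piece E W x"
  by (simp add: piece_def)

lemma piece_subset: "x \<in> W \<Longrightarrow> piece E W x \<subseteq> W"
  by (auto simp: piece_def elim: rtranclp.cases)

lemma walk_sym:
  assumes "simple_graph W E" "walk E W x y"
  shows "walk E W y x"
  using assms(2)
proof (induction rule: rtranclp_induct)
  case (step y z)
  then have "E z y" using simple_graph_sym[OF assms(1), of y z] by blast
  with step have "walk E W z y" by (intro r_into_rtranclp) auto
  then show ?case using step(3) by (rule rtranclp_trans)
qed auto

lemma piece_eq:
  assumes "simple_graph W E" "y \<in> piece E W x"
  shows "piece E W y = piece E W x"
  using assms(2) walk_sym[OF assms(1)] unfolding piece_def
  by (auto intro: rtranclp_trans)

lemma nbhd_piece_outside: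
  assumes "x \<in> W" "W \<subseteq> V"
  shows "nbhd E V (piece E W x) \<subseteq> V - W"
proof
  fix y assume "y \<in> nbhd E V (piece E W x)"
  then obtain z where z: "y \<in> V" "y \<notin> piece E W x" "z \<in> piece E W x" "E z y" by (auto simp: nbhd_def)
  have "z \<in> W" using z(3) piece_subset[OF assms(1)] by auto
  then have "y \<notin> W" using z by (auto simp: piece_def intro: rtranclp.rtrancl_into_rtrancl)
  then show "y \<in> V - W" using z by auto
qed

text \<open>Two attachment vertices \<open>x\<close> and \<open>y\<close> are joined by a walk
  through the piece, hence by an induced path whose inner vertices avoid \<open>T\<close>. Convexity
  leaves no inner vertex, so the path is a single edge.\<close>

lemma convex_nbhd_piece:
  assumes "simple_graph V E" "monophonically_convex V E T" "s \<in> V - T"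
  shows "pairwise E (nbhd E V (piece E (V - T) s))"
  unfolding pairwise_def
proof (intro ballI impI)
  let ?C = "piece E (V - T) s"
  fix x y assume xy: "x \<in> nbhd E V ?C" "y \<in> nbhd E V ?C" "x \<noteq> y"
  have CV: "?C \<subseteq> V - T" by (rule piece_subset[OF assms(3)])
  have T: "x \<in> T" "y \<in> T"
    using nbhd_piece_outside[OF assms(3), of V E] xy by auto
  obtain x' y' where x': "x' \<in> ?C" "E x' x" and y': "y' \<in> ?C" "E y' y" and V: "x \<in> V" "y \<in> V"
    using xy by (auto simp: nbhd_def)
  let ?A = "insert x (insert y (V - T))"
  have mono: "walk E (V - T) a b \<Longrightarrow> walk E ?A a b" for a b
    by (erule rtranclp_mono[THEN predicate2D, rotated]) auto
  have "walk E (V - T) s x'" using x'(1) by (simp add: piece_def)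
  then have "walk E (V - T) x' s" by (rule walk_sym[OF simple_graph_subset[OF assms(1) Diff_subset]])
  moreover have "walk E (V - T) s y'" using y'(1) by (auto simp: piece_def)
  ultimately have "walk E ?A x' y'" by (intro mono) (rule rtranclp_trans)
  moreover have "E x x'" using simple_graph_sym[OF assms(1) _ V(1) x'(2)] x' CV by auto
  then have "walk E ?A x x'" using x' CV by (intro r_into_rtranclp) auto
  moreover have "walk E ?A y' y" using y' CV by (intro r_into_rtranclp) auto
  ultimately have "walk E ?A x y" by (meson rtranclp_trans)
  then obtain p where p: "induced_path ?A E p" "hd p = x" "last p = y"
    by (rule walk_induced_path) auto
  have "induced_path V E p" using p(1) by (rule induced_path_mono) (use V in auto)
  then have "set p \<subseteq> T" using convex_path[OF assms(2)] p T by auto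
  then have "set p \<subseteq> {x, y}" using p(1) by (auto simp: induced_path_def)
  moreover have "distinct p" "p \<noteq> []" using p(1) by (auto simp: induced_path_def)
  ultimately have "p = [x, y]"
    using p(2,3) xy(3) by (cases p; cases "tl p") (auto split: if_splits)
  then show "E x y" using p(1) by (auto simp: induced_path_def)
qed

text \<open>The component \<open>C\<close> of \<open>W - T\<close> at \<open>s\<close> is attached
  by a clique \<open>K\<close> contained in \<open>T\<close>, so some petal \<open>M\<close> lies in
  \<open>C \<union> K\<close>. Since \<open>T\<close> meets the interior of \<open>M\<close>, which
  can only happen in \<open>K\<close>, all of \<open>K\<close> lies in \<open>M\<close>. It remains
  to see that all of \<open>C\<close> is interior to \<open>M\<close>.\<close>

lemma petal_of_missed_vertex:
  assumes G: "simple_graph W E" and T: "monophonically_convex W E T"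
    and hits: "\<And>M. M \<in> petals W E \<Longrightarrow> T \<inter> mp_interior W E M \<noteq> {}" and s: "s \<in> W - T"
  obtains M where "M \<in> petals W E" "s \<in> mp_interior W E M"
    "pairwise E (mp_boundary W E M \<union> (T \<inter> M))"
proof -
  define C where "C = piece E (W - T) s"
  define K where "K = nbhd E W C"
  have sC: "s \<in> C" by (simp add: C_def piece_self)
  have CT: "C \<subseteq> W - T" unfolding C_def by (rule piece_subset[OF s])
  have K: "pairwise E K" using convex_nbhd_piece[OF G T s] by (simp add: K_def C_def)
  have KW: "K \<subseteq> W" by (auto simp: K_def nbhd_def)
  have finW: "finite W" using G by (rule simple_graph_finite)
  obtain M where M: "M \<in> petals W E" "M \<subseteq> C \<union> K" "M \<inter> C \<noteq> {}"
    using petal_behind[OF G, of C] sC CT K unfolding K_def by blast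
  have mp: "mp_subgraph W E M" using M(1) by (rule petals_mp)
  obtain k where k: "k \<in> T" "k \<in> mp_interior W E M" using hits[OF M(1)] by auto
  then have "k \<in> K" using M(2) CT mp_interior_subset[of W E M] by auto
  then have KM: "K \<subseteq> M" using mp_interior_prime[OF finW k(2) prime_graph_clique[OF K] KW] by simp
  \<comment> \<open>A vertex of \<open>C\<close> outside \<open>M\<close> would yield a second petal
    \<open>M'\<close> inside \<open>C - M\<close> and the boundary of \<open>M\<close>. Every vertex
    of \<open>T\<close> in \<open>M'\<close> then lies in \<open>M\<close>, yet one of them is
    interior to \<open>M'\<close>.\<close>
  have CM: "C \<subseteq> M"
  proof (rule ccontr)
    assume "\<not> C \<subseteq> M"
    then have D: "C - M \<subseteq> W - M" "C - M \<noteq> {}" using CT by auto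
    have "nbhd E W (C - M) \<subseteq> M"
      using KM by (auto simp: nbhd_def K_def)
    then obtain M' where M': "M' \<in> petals W E" "M' \<noteq> M" "M' \<subseteq> (C - M) \<union> mp_boundary W E M"
      by (rule petal_through[OF mp G D petals_boundary[OF M(1)]])
    obtain t where t: "t \<in> T" "t \<in> mp_interior W E M'" using hits[OF M'(1)] by auto
    then have "t \<in> M" using M'(3) CT mp_interior_subset[of W E M'] mp_boundary_subset[of W E M] by blast
    then show False using mp_interior_unique[OF t(2) mp] M'(2) by simp
  qed
  have CI: "c \<in> mp_interior W E M" if c: "c \<in> C" for c
  proof (rule ccontr)
    assume "c \<notin> mp_interior W E M"
    then obtain N where N: "mp_subgraph W E N" "N \<noteq> M" "c \<in> N"
      using c CM by (auto simp: mp_interior_def mp_boundary_def)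
    have "N \<subseteq> C \<union> K"
      using prime_graph_side[OF mp_subgraph_prime[OF N(1)] mp_subgraph_subset[OF N(1)] _ K, of C] N(3) c
      by (auto simp: K_def)
    then have "N \<subseteq> M" using CM KM by auto
    then show False
      using mp_subgraph_maximal[OF N(1) mp_subgraph_prime[OF mp] mp_subgraph_subset[OF mp]] N(2) by simp
  qed
  have "mp_boundary W E M \<union> (T \<inter> M) \<subseteq> K"
    using M(2) CT CI mp_boundary_subset[of W E M] by (auto simp: mp_interior_def)
  then have "pairwise E (mp_boundary W E M \<union> (T \<inter> M))" by (rule pairwise_subset[OF K])
  then show thesis using that M(1) CI[OF sC] by blast
qed

text \<open>Convex sets that contain \<open>S - {s}\<close> but not \<open>s\<close> serve as
  certificates of independence in place of the hull: they can be restricted to subgraphs, and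
  carried over to larger graphs by \<open>convex_trans\<close>.\<close>

lemma independentD:
  assumes "monophonically_independent W E S" "s \<in> S"
  obtains T where "monophonically_convex W E T" "S - {s} \<subseteq> T" "s \<notin> T"
proof
  have "S \<subseteq> W" using assms by (simp add: monophonically_independent_def)
  then show "monophonically_convex W E (monophonically_convex W E hull (S - {s}))"
    by (intro convex_hull) auto
  show "S - {s} \<subseteq> monophonically_convex W E hull (S - {s})" by (rule hull_subset)
  show "s \<notin> monophonically_convex W E hull (S - {s})"
    using assms by (simp add: monophonically_independent_def)
qed

lemma independentI:
  assumes "S \<subseteq> W"
    and "\<And>s. s \<in> S \<Longrightarrow> \<exists>T. monophonically_convex W E T \<and> S - {s} \<subseteq> T \<and> s \<notin> T"
  shows "monophonically_independent W E S"
  unfolding monophonically_independent_def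
proof (intro conjI ballI assms(1))
  fix s assume "s \<in> S"
  then obtain T where T: "monophonically_convex W E T" "S - {s} \<subseteq> T" "s \<notin> T" using assms(2) by blast
  show "s \<notin> monophonically_convex W E hull (S - {s})"
    using hull_minimal[of "S - {s}" T "monophonically_convex W E"] T by blast
qed

lemma independent_sub:
  assumes "monophonically_independent V E S" "S' \<subseteq> S" "S' \<subseteq> W" "W \<subseteq> V"
  shows "monophonically_independent W E S'"
proof (rule independentI[OF assms(3)])
  fix s assume s: "s \<in> S'"
  then obtain T where T: "monophonically_convex V E T" "S - {s} \<subseteq> T" "s \<notin> T"
    using independentD[OF assms(1)] assms(2) by blast
  show "\<exists>T. monophonically_convex W E T \<and> S' - {s} \<subseteq> T \<and> s \<notin> T"
    using convex_restrict[OF T(1) assms(4)] T(2,3) assms(2,3) by (intro exI[of _ "T \<inter> W"]) auto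
qed

lemma independent_super:
  assumes "monophonically_independent W E S" "monophonically_convex V E W"
  shows "monophonically_independent V E S"
proof (rule independentI)
  show "S \<subseteq> V" using assms convex_subset[OF assms(2)] by (auto simp: monophonically_independent_def)
  fix s assume s: "s \<in> S"
  then show "\<exists>T. monophonically_convex V E T \<and> S - {s} \<subseteq> T \<and> s \<notin> T"
    using independentD[OF assms(1)] convex_trans[OF assms(2)] by metis
qed

subsection \<open>Independent sets and flower subgraphs\<close>

lemma petals2I:
  assumes "M \<in> petals W E" "u \<in> mp_interior W E M" "v \<in> mp_interior W E M" "u \<noteq> v"
    "\<And>w. w \<in> mp_boundary W E M \<Longrightarrow> E w u \<and> E w v"
  shows "M \<in> petals2 W E"
proof -
  have "stamen_set2 W E M {u, v}" using assms(2-5) by (auto simp: stamen_set2_def)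
  then show ?thesis using assms(1) by (auto simp: petals2_def)
qed

lemma petals2E:
  assumes "M \<in> petals2 W E"
  obtains u v where "u \<in> mp_interior W E M" "v \<in> mp_interior W E M" "u \<noteq> v"
    "\<forall>w\<in>mp_boundary W E M. E w u \<and> E w v"
  using assms unfolding petals2_def stamen_set2_def by blast

lemma petals_interior_disjoint:
  assumes "M \<in> petals W E" "N \<in> petals W E" "M \<noteq> N"
  shows "mp_interior W E M \<inter> mp_interior W E N = {}"
  using assms mp_interior_unique[OF _ petals_mp[OF assms(2)]] mp_interior_subset[of W E N] by blast

lemma card_gt_2_avoid:
  assumes "card A \<ge> 3"
  obtains s where "s \<in> A" "s \<noteq> x" "s \<noteq> y"
proof -
  have "\<not> A \<subseteq> {x, y}"
  proof
    assume "A \<subseteq> {x, y}"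
    then have "card A \<le> card {x, y}" by (intro card_mono) auto
    also have "\<dots> \<le> 2" by (simp add: card_insert_if)
    finally show False using assms by simp
  qed
  then show thesis using that by blast
qed

text \<open>Each \<open>s\<close> in \<open>S\<close> is removed in turn. If \<open>S - {s}\<close>
  still meets all petal interiors, \<open>petal_of_missed_vertex\<close> applies to a certificate
  for \<open>s\<close>; otherwise \<open>s\<close> is the only vertex of \<open>S\<close> in some
  petal interior.\<close>

lemma independent_petal_cases:
  assumes G: "simple_graph W E" and S: "monophonically_independent W E S"
    and hits: "\<And>M. M \<in> petals W E \<Longrightarrow> S \<inter> mp_interior W E M \<noteq> {}"
  shows "S \<subseteq> (\<Union>M\<in>petals W E. mp_interior W E M)"
    and "\<And>M. M \<in> petals W E \<Longrightarrow> card (S \<inter> mp_interior W E M) = 2 \<Longrightarrow> M \<in> petals2 W E"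
    and "\<And>M. M \<in> petals W E \<Longrightarrow> card (S \<inter> mp_interior W E M) \<ge> 3 \<Longrightarrow>
           pairwise E (mp_boundary W E M \<union> (S \<inter> mp_interior W E M))"
proof -
  have SW: "S \<subseteq> W" using S by (simp add: monophonically_independent_def)
  have key: "(\<exists>M\<in>petals W E. s \<in> mp_interior W E M) \<and>
      (\<forall>M\<in>petals W E. s \<in> mp_interior W E M \<longrightarrow> card (S \<inter> mp_interior W E M) \<ge> 2 \<longrightarrow>
        pairwise E (mp_boundary W E M \<union> (S \<inter> mp_interior W E M - {s})))"
    if s: "s \<in> S" for s
  proof (cases "\<exists>M\<in>petals W E. (S - {s}) \<inter> mp_interior W E M = {}")
    case True
    then obtain M where M: "M \<in> petals W E" "(S - {s}) \<inter> mp_interior W E M = {}" by blast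
    then have sM: "S \<inter> mp_interior W E M = {s}" using hits[OF M(1)] by blast
    have "\<not> card (S \<inter> mp_interior W E N) \<ge> 2" if N: "N \<in> petals W E" "s \<in> mp_interior W E N" for N
    proof -
      have "N = M" using petals_interior_disjoint[OF N(1) M(1)] sM N(2) by blast
      then show ?thesis using sM by simp
    qed
    then show ?thesis using sM M(1) by blast
  next
    case False
    obtain T where T: "monophonically_convex W E T" "S - {s} \<subseteq> T" "s \<notin> T"
      by (rule independentD[OF S s])
    obtain M where M: "M \<in> petals W E" "s \<in> mp_interior W E M" "pairwise E (mp_boundary W E M \<union> (T \<inter> M))"
    proof (rule petal_of_missed_vertex[OF G T(1)])
      show "T \<inter> mp_interior W E M \<noteq> {}" if "M \<in> petals W E" for M using False T(2) that by blast
      show "s \<in> W - T" using T(3) s SW by blast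
    qed
    have "pairwise E (mp_boundary W E N \<union> (S \<inter> mp_interior W E N - {s}))"
      if N: "N \<in> petals W E" "s \<in> mp_interior W E N" for N
    proof -
      have "N = M" using petals_interior_disjoint[OF N(1) M(1)] M(2) N(2) by blast
      moreover have "mp_boundary W E M \<union> (S \<inter> mp_interior W E M - {s}) \<subseteq> mp_boundary W E M \<union> (T \<inter> M)"
        using T(2) mp_interior_subset[of W E M] by blast
      ultimately show ?thesis using pairwise_subset[OF M(3)] by simp
    qed
    then show ?thesis using M(1,2) by blast
  qed
  show "S \<subseteq> (\<Union>M\<in>petals W E. mp_interior W E M)" using key by blast
  \<comment> \<open>Adjacency of \<open>x\<close> and \<open>y\<close> follows by removing a further
    vertex \<open>s\<close> of \<open>S\<close> from the same interior. With two vertices of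
    \<open>S\<close> there, removing one joins the other to the boundary; with three or more, some
    vertex can be removed for every pair.\<close>
  have edge: "E x y" if M: "M \<in> petals W E" and s: "s \<in> S \<inter> mp_interior W E M" "card (S \<inter> mp_interior W E M) \<ge> 2"
      "s \<noteq> x" "s \<noteq> y" "x \<noteq> y"
      and xy: "x \<in> mp_boundary W E M \<union> (S \<inter> mp_interior W E M)" "y \<in> mp_boundary W E M \<union> (S \<inter> mp_interior W E M)"
    for M s x y
  proof -
    have "pairwise E (mp_boundary W E M \<union> (S \<inter> mp_interior W E M - {s}))"
      using key[of s] M s(1,2) by blast
    moreover have "x \<in> mp_boundary W E M \<union> (S \<inter> mp_interior W E M - {s})"
        "y \<in> mp_boundary W E M \<union> (S \<inter> mp_interior W E M - {s})" using xy s by auto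
    ultimately show ?thesis using s(5) unfolding pairwise_def by blast
  qed
  have notin: "w \<notin> mp_interior W E M" if "w \<in> mp_boundary W E M" for w M
    using that by (simp add: mp_interior_def)
  show "M \<in> petals2 W E" if M: "M \<in> petals W E" and c: "card (S \<inter> mp_interior W E M) = 2" for M
  proof -
    obtain u v where uv: "S \<inter> mp_interior W E M = {u, v}" "u \<noteq> v" using c by (auto simp: card_2_iff)
    show ?thesis
    proof (rule petals2I[OF M, of u v])
      show "u \<in> mp_interior W E M" "v \<in> mp_interior W E M" using uv by auto
      fix w assume w: "w \<in> mp_boundary W E M"
      then have "w \<noteq> u" "w \<noteq> v" using notin[OF w] uv by auto
      then show "E w u \<and> E w v"
        using edge[OF M, of v w u] edge[OF M, of u w v] uv c w by auto
    qed (rule uv(2))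
  qed
  show "pairwise E (mp_boundary W E M \<union> (S \<inter> mp_interior W E M))"
    if M: "M \<in> petals W E" and c: "card (S \<inter> mp_interior W E M) \<ge> 3" for M
    unfolding pairwise_def
  proof (intro ballI impI)
    fix x y assume xy: "x \<in> mp_boundary W E M \<union> (S \<inter> mp_interior W E M)"
      "y \<in> mp_boundary W E M \<union> (S \<inter> mp_interior W E M)" "x \<noteq> y"
    obtain s where "s \<in> S \<inter> mp_interior W E M" "s \<noteq> x" "s \<noteq> y" by (rule card_gt_2_avoid[OF c])
    then show "E x y" using edge[OF M, of s x y] xy c by auto
  qed
qed

lemma independent_card_le:
  assumes G: "simple_graph W E" and S: "monophonically_independent W E S"
    and hits: "\<And>M. M \<in> petals W E \<Longrightarrow> S \<inter> mp_interior W E M \<noteq> {}"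
    and le2: "\<And>M. M \<in> petals W E \<Longrightarrow> card (S \<inter> mp_interior W E M) \<le> 2"
  shows "card S \<le> card (petals W E) + card (petals2 W E)"
proof -
  have fin: "finite (petals W E)" using G by (simp add: finite_petals simple_graph_finite)
  have finS: "finite S"
    using S finite_subset simple_graph_finite[OF G] by (auto simp: monophonically_independent_def)
  have "S = (\<Union>M\<in>petals W E. S \<inter> mp_interior W E M)" using independent_petal_cases(1)[OF G S hits] by blast
  then have "card S = card (\<Union>M\<in>petals W E. S \<inter> mp_interior W E M)" by simp
  also have "\<dots> \<le> (\<Sum>M\<in>petals W E. card (S \<inter> mp_interior W E M))" by (rule card_UN_le[OF fin])
  also have "\<dots> \<le> (\<Sum>M\<in>petals W E. 1 + (if M \<in> petals2 W E then 1 else 0))"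
  proof (rule sum_mono)
    fix M assume M: "M \<in> petals W E"
    show "card (S \<inter> mp_interior W E M) \<le> 1 + (if M \<in> petals2 W E then 1 else 0)"
      using le2[OF M] independent_petal_cases(2)[OF G S hits M] by (cases "card (S \<inter> mp_interior W E M) = 2") auto
  qed
  also have "\<dots> = card (petals W E) + card (petals W E \<inter> petals2 W E)"
    unfolding sum.distrib using fin by (simp add: sum.If_cases Int_def)
  also have "petals W E \<inter> petals2 W E = petals2 W E" using petals2_subset by blast
  finally show ?thesis .
qed

text \<open>An mp-subgraph of \<open>W\<close> with a triangle lies in an mp-subgraph of
  \<open>V\<close>, which is already that triangle.\<close>

lemma Gamma1_subset:
  assumes "simple_graph V E" "Gamma1 V E" "W \<subseteq> V"
  shows "Gamma1 W E"
  unfolding Gamma1_def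
proof (intro conjI allI impI)
  show "\<not> contains_K W E 4" using assms by (auto simp: Gamma1_def contains_K_def)
  fix M assume M: "mp_subgraph W E M \<and> contains_K M E 3"
  then obtain N where N: "mp_subgraph V E N" "M \<subseteq> N"
    using prime_graph_in_mp_subgraph[OF simple_graph_finite[OF assms(1)]] assms(3)
    by (metis mp_subgraph_prime mp_subgraph_subset order_trans)
  obtain C where C: "C \<subseteq> M" "induces_K E 3 C" using M by (auto simp: contains_K_def)
  have "contains_K N E 3" using C N by (auto simp: contains_K_def)
  then have "induces_K E 3 N" using assms(2) N by (auto simp: Gamma1_def)
  then have "C = N" using C N by (intro card_subset_eq) (auto simp: induces_K_def)
  then show "induces_K E 3 M" using C N by auto
qed

lemma Gamma1_triangle:
  assumes "Gamma1 W E" "mp_subgraph W E M" "C \<subseteq> M" "induces_K E 3 C"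
  shows "M = C"
proof -
  have "induces_K E 3 M" using assms by (auto simp: Gamma1_def contains_K_def)
  then show ?thesis using assms(3,4) card_subset_eq[of M C] by (auto simp: induces_K_def)
qed

lemma flower_subset: "flower_subgraph V E W \<Longrightarrow> W \<subseteq> V"
  by (induction rule: flower_subgraph.induct) auto

text \<open>The neighbourhood of a removed interior lies in the clique boundary, so
  \<open>convex_diff\<close> covers each removal step, and convexity is transitive.\<close>

lemma flower_convex:
  assumes "simple_graph V E" "flower_subgraph V E W"
  shows "monophonically_convex V E W"
  using assms(2)
proof (induction rule: flower_subgraph.induct)
  case refl
  show ?case by (rule convex_whole)
next
  case (step W M)
  have G: "simple_graph W E" by (rule simple_graph_subset[OF assms(1) flower_subset[OF step(1)]])
  have "pairwise E (nbhd E W (mp_interior W E M))"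
    by (rule pairwise_subset[OF petals_boundary[OF step(2)] nbhd_mp_interior[OF G petals_mp[OF step(2)]]])
  moreover have "mp_interior W E M \<subseteq> W" using mp_interior_subset petals_subset[OF step(2)] by fast
  ultimately show ?case using convex_trans[OF step(3)] convex_diff[OF G] by blast
qed

text \<open>Passing to \<open>W\<close> can only shrink the boundary of \<open>M\<close>: another
  mp-subgraph of \<open>W\<close> through a vertex of \<open>M\<close> extends to one of
  \<open>V\<close>, which differs from \<open>M\<close> by maximality.\<close>

lemma petals_transfer:
  assumes "simple_graph V E" "M \<in> petals V E" "M \<subseteq> W" "W \<subseteq> V"
  shows "M \<in> petals W E"
proof -
  have "\<not> prime_graph N E" if "M \<subset> N" "N \<subseteq> W" for N
    using mp_subgraph_maximal[OF petals_mp[OF assms(2)], of N] that assms(4) by auto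
  then have mp: "mp_subgraph W E M"
    using petals_prime[OF assms(2)] assms(3) by (simp add: mp_subgraph_def)
  have bd: "mp_boundary W E M \<subseteq> mp_boundary V E M"
  proof
    fix v assume "v \<in> mp_boundary W E M"
    then obtain N where N: "v \<in> M" "mp_subgraph W E N" "N \<noteq> M" "v \<in> N" by (auto simp: mp_boundary_def)
    obtain N' where N': "mp_subgraph V E N'" "N \<subseteq> N'"
      using prime_graph_in_mp_subgraph[OF simple_graph_finite[OF assms(1)]] N(2) assms(4)
      by (metis mp_subgraph_prime mp_subgraph_subset order_trans)
    have "N' \<noteq> M"
      using mp_subgraph_maximal[OF N(2) petals_prime[OF assms(2)] assms(3)] N(3) N'(2) by blast
    then show "v \<in> mp_boundary V E M" using N N' by (auto simp: mp_boundary_def)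
  qed
  then have "mp_interior W E M \<noteq> {}" using petals_interior[OF assms(2)] by (auto simp: mp_interior_def)
  then show ?thesis using mp pairwise_subset[OF petals_boundary[OF assms(2)] bd] by (simp add: petals_def)
qed

section \<open>What lies behind a petal of a convex subgraph\<close>

text \<open>
  The vertices of \<open>V\<close> that the boundary of \<open>Q\<close> separates from the rest of \<open>H\<close>: the interior of
  \<open>Q\<close>, and the components of \<open>V - H\<close> attached to it.
\<close>
definition behind :: "'a set \<Rightarrow> ('a \<Rightarrow> 'a \<Rightarrow> bool) \<Rightarrow> 'a set \<Rightarrow> 'a set \<Rightarrow> 'a set" where
  "behind V E H Q = mp_interior H E Q \<union>
     {y \<in> V - H. nbhd E V (piece E (V - H) y) \<inter> mp_interior H E Q \<noteq> {}}"

lemma behind_subset: "H \<subseteq> V \<Longrightarrow> Q \<subseteq> H \<Longrightarrow> behind V E H Q \<subseteq> V"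
  using mp_interior_subset[of H E Q] by (auto simp: behind_def)

lemma behind_Int: "Q \<subseteq> H \<Longrightarrow> behind V E H Q \<inter> H = mp_interior H E Q"
  using mp_interior_subset[of H E Q] by (auto simp: behind_def)

text \<open>Applied to flower subgraphs \<open>H\<close>, which are convex by
  \<open>flower_convex\<close>.\<close>

locale convex_subgraph =
  fixes V :: "'a set" and E H
  assumes V: "simple_graph V E" and H: "monophonically_convex V E H"
begin

lemma HV: "H \<subseteq> V"
  using H by (rule convex_subset)

lemma HG: "simple_graph H E"
  by (rule simple_graph_subset[OF V HV])

lemma piece_nbhd:
  assumes "y \<in> V - H"
  shows "pairwise E (nbhd E V (piece E (V - H) y))" "nbhd E V (piece E (V - H) y) \<subseteq> H"
  using convex_nbhd_piece[OF V H assms] nbhd_piece_outside[OF assms, of V E] by auto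

text \<open>The attachment of a component of \<open>V - H\<close> is a clique, and a clique through
  an interior vertex of \<open>Q\<close> stays in \<open>Q\<close>. Thus no component is attached to
  the interiors of two mp-subgraphs.\<close>

lemma piece_nbhd_petal:
  assumes "y \<in> V - H" "mp_subgraph H E Q" "nbhd E V (piece E (V - H) y) \<inter> mp_interior H E Q \<noteq> {}"
  shows "nbhd E V (piece E (V - H) y) \<subseteq> Q"
  using mp_interior_prime[OF simple_graph_finite[OF HG] _ prime_graph_clique[OF piece_nbhd(1)[OF assms(1)]]]
    piece_nbhd(2)[OF assms(1)] assms(3) by blast

lemma behind_piece:
  assumes "y \<in> behind V E H Q - H" "z \<in> piece E (V - H) y" "Q \<subseteq> H"
  shows "z \<in> behind V E H Q - H"
proof -
  have y: "y \<in> V - H" "nbhd E V (piece E (V - H) y) \<inter> mp_interior H E Q \<noteq> {}"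
    using assms(1,3) mp_interior_subset[of H E Q] by (auto simp: behind_def)
  then show ?thesis
    using assms(2) piece_subset[OF y(1), of E] piece_eq[OF simple_graph_subset[OF V] assms(2)]
    by (auto simp: behind_def)
qed

lemma behind_disjoint:
  assumes "mp_subgraph H E Q" "mp_subgraph H E Q'" "Q \<noteq> Q'"
  shows "behind V E H Q \<inter> behind V E H Q' = {}"
proof (rule ccontr)
  assume "\<not> ?thesis"
  then obtain y where y: "y \<in> behind V E H Q" "y \<in> behind V E H Q'" by blast
  have "\<exists>x. x \<in> mp_interior H E Q' \<and> x \<in> Q"
  proof (cases "y \<in> H")
    case True
    then show ?thesis using y mp_interior_subset[of H E Q] by (auto simp: behind_def)
  next
    case False
    have *: "mp_interior H E Q \<subseteq> H" "mp_interior H E Q' \<subseteq> H"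
      using assms mp_interior_subset mp_subgraph_subset by fast+
    then have "y \<in> V - H" "nbhd E V (piece E (V - H) y) \<inter> mp_interior H E Q \<noteq> {}"
      "nbhd E V (piece E (V - H) y) \<inter> mp_interior H E Q' \<noteq> {}"
      using y False by (auto simp: behind_def)
    then show ?thesis using piece_nbhd_petal[OF _ assms(1)] by blast
  qed
  then show False using mp_interior_unique[OF _ assms(1)] assms(3) by blast
qed

text \<open>An edge leaving an interior vertex of \<open>Q\<close> stays in \<open>Q\<close> or
  enters a component lying behind \<open>Q\<close>; an edge leaving such a component ends in its
  attachment, which lies in \<open>Q\<close>. For a petal \<open>Q\<close>, the set behind it thus
  has a clique neighbourhood.\<close>

lemma nbhd_behind:
  assumes "mp_subgraph H E Q"
  shows "nbhd E V (behind V E H Q) \<subseteq> mp_boundary H E Q"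
proof
  fix z assume "z \<in> nbhd E V (behind V E H Q)"
  then obtain y where z: "z \<in> V" "z \<notin> behind V E H Q" and y: "y \<in> behind V E H Q" "E y z"
    by (auto simp: nbhd_def)
  have QH: "Q \<subseteq> H" using assms by (rule mp_subgraph_subset)
  have yV: "y \<in> V" using behind_subset[OF HV QH] y by blast
  have Ezy: "E z y" using simple_graph_sym[OF V yV z(1) y(2)] .
  have "z \<in> Q"
  proof (cases "y \<in> H")
    case True
    then have yI: "y \<in> mp_interior H E Q" using y behind_Int[OF QH] by blast
    have "z \<in> H"
    proof (rule ccontr)
      assume zH: "z \<notin> H"
      then have "y \<in> nbhd E V (piece E (V - H) z)"
        using True yV Ezy piece_subset[of z "V - H" E] z(1) piece_self[of z E "V - H"]
        by (auto simp: nbhd_def)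
      then have "z \<in> behind V E H Q" using yI z(1) zH by (auto simp: behind_def)
      then show False using z(2) by simp
    qed
    then show ?thesis using mp_interior_edge[OF HG yI assms] y(2) by blast
  next
    case False
    then have y': "y \<in> V - H" "nbhd E V (piece E (V - H) y) \<inter> mp_interior H E Q \<noteq> {}"
      using y mp_interior_subset[of H E Q] QH by (auto simp: behind_def)
    have "z \<notin> piece E (V - H) y" using behind_piece[of y Q z] y False z QH by blast
    then have "z \<in> nbhd E V (piece E (V - H) y)"
      using z y(2) piece_self[of y E "V - H"] by (auto simp: nbhd_def)
    then show ?thesis using piece_nbhd_petal[OF y'(1) assms y'(2)] by blast
  qed
  moreover have "z \<notin> mp_interior H E Q" using z(2) by (auto simp: behind_def)
  ultimately show "z \<in> mp_boundary H E Q" by (auto simp: mp_interior_def)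
qed

lemma prime_behind:
  assumes "Q \<in> petals H E" "prime_graph N E" "N \<subseteq> V" "N \<inter> behind V E H Q \<noteq> {}"
  shows "N \<subseteq> behind V E H Q \<union> mp_boundary H E Q"
  by (rule prime_graph_side[OF assms(2,3,4) petals_boundary[OF assms(1)] nbhd_behind[OF petals_mp[OF assms(1)]]])

text \<open>A prime set reaching behind \<open>Q\<close> stays there or in the boundary of
  \<open>Q\<close>, and neither contains a vertex behind \<open>Q'\<close>. Hence a petal of
  \<open>V\<close> is charged to at most one petal of \<open>H\<close> in the counts below.\<close>

lemma prime_behind_unique:
  assumes "Q \<in> petals H E" "Q' \<in> petals H E" "Q \<noteq> Q'" "prime_graph N E" "N \<subseteq> V"
    "N \<inter> behind V E H Q \<noteq> {}"
  shows "N \<inter> behind V E H Q' = {}"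
proof -
  have "mp_boundary H E Q \<inter> behind V E H Q' \<subseteq> Q \<inter> mp_interior H E Q'"
    using mp_boundary_subset[of H E Q] petals_subset[OF assms(1)] behind_Int[OF petals_subset[OF assms(2)]] by blast
  also have "\<dots> = {}" using mp_interior_unique[OF _ petals_mp[OF assms(1)]] assms(3) by blast
  finally show ?thesis
    using prime_behind[OF assms(1,4,5,6)] behind_disjoint[OF petals_mp[OF assms(1)] petals_mp[OF assms(2)] assms(3)]
    by blast
qed

text \<open>The trace on \<open>G\<close> of the set behind \<open>Q\<close> still contains the
  interior of \<open>Q\<close> and has its neighbourhood within the boundary of \<open>Q\<close>, so
  \<open>petal_behind\<close> applies.\<close>

lemma ex_petal_behind:
  assumes "Q \<in> petals H E" "H \<subseteq> G" "G \<subseteq> V"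
  shows "\<exists>M\<in>petals G E. M \<inter> behind V E H Q \<noteq> {}"
proof -
  let ?C = "behind V E H Q \<inter> G"
  have "nbhd E G ?C \<subseteq> nbhd E V (behind V E H Q)" using assms(3) by (auto simp: nbhd_def)
  then have "nbhd E G ?C \<subseteq> mp_boundary H E Q" using nbhd_behind[OF petals_mp[OF assms(1)]] by blast
  then have cl: "pairwise E (nbhd E G ?C)" by (rule pairwise_subset[OF petals_boundary[OF assms(1)]])
  have "mp_interior H E Q \<subseteq> ?C" using behind_Int[OF petals_subset[OF assms(1)]] assms(2) by blast
  then have "?C \<noteq> {}" using petals_interior[OF assms(1)] by blast
  then obtain M where "M \<in> petals G E" "M \<inter> ?C \<noteq> {}"
    using petal_behind[OF simple_graph_subset[OF V assms(3)] Int_lower2 _ cl] by metis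
  then show ?thesis by blast
qed

lemma card_petals_le: "card (petals H E) \<le> card (petals V E)"
proof -
  have "\<forall>Q\<in>petals H E. \<exists>M. M \<in> petals V E \<and> M \<inter> behind V E H Q \<noteq> {}"
    using ex_petal_behind[OF _ HV] by blast
  then obtain f where f: "\<And>Q. Q \<in> petals H E \<Longrightarrow> f Q \<in> petals V E \<and> f Q \<inter> behind V E H Q \<noteq> {}"
    by metis
  have "inj_on f (petals H E)"
  proof (rule inj_onI, rule ccontr)
    fix Q Q' assume Q: "Q \<in> petals H E" "Q' \<in> petals H E" "f Q = f Q'" "Q \<noteq> Q'"
    have p: "prime_graph (f Q) E" "f Q \<subseteq> V" using f[OF Q(1)] by (auto dest: petals_prime petals_subset)
    show False using prime_behind_unique[OF Q(1,2,4) p] f[OF Q(1)] f[OF Q(2)] Q(3) by simp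
  qed
  then show ?thesis using f by (intro card_inj_on_le[of f]) (auto intro: finite_petals simple_graph_finite[OF V])
qed

end

section \<open>Flower subgraphs with as many petals as the whole graph\<close>

context convex_subgraph
begin

text \<open>With empty boundary the set behind \<open>Q\<close> has empty neighbourhood. So
  \<open>M\<close> stays inside it, and a part of it beyond \<open>M\<close> would carry a second
  petal by \<open>petal_through\<close>.\<close>

lemma behind_unique_petal:
  assumes Q: "Q \<in> petals H E" "mp_boundary H E Q = {}"
    and uniq: "{M \<in> petals V E. M \<inter> behind V E H Q \<noteq> {}} = {M}"
  shows "behind V E H Q = M"
proof -
  have nb: "nbhd E V (behind V E H Q) = {}" using nbhd_behind[OF petals_mp[OF Q(1)]] Q(2) by simp
  have M: "M \<in> petals V E" "M \<inter> behind V E H Q \<noteq> {}" using uniq by blast+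
  have sub: "M \<subseteq> behind V E H Q"
    using prime_behind[OF Q(1) petals_prime[OF M(1)] petals_subset[OF M(1)] M(2)] Q(2) by simp
  moreover have "behind V E H Q \<subseteq> M"
  proof (rule ccontr)
    assume n: "\<not> behind V E H Q \<subseteq> M"
    let ?D = "behind V E H Q - M"
    have D: "?D \<subseteq> V - M" "?D \<noteq> {}" using n behind_subset[OF HV petals_subset[OF Q(1)]] by auto
    have "nbhd E V ?D \<subseteq> M" using nb by (auto simp: nbhd_def)
    then obtain M' where "M' \<in> petals V E" "M' \<noteq> M" "M' \<inter> ?D \<noteq> {}"
      using petal_through[OF petals_mp[OF M(1)] V D petals_boundary[OF M(1)]] by metis
    then show False using uniq by blast
  qed
  ultimately show ?thesis by blast
qed

text \<open>Compared with \<open>Q\<close>, the interior in \<open>G\<close> can only grow and the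
  boundary can only shrink, so the two vertices that make \<open>Q\<close> of Type 2 still
  do.\<close>

lemma petals2_behind:
  assumes Q: "Q \<in> petals2 H E" and G: "H \<subseteq> G" "G \<subseteq> V"
    and pr: "prime_graph ((behind V E H Q \<inter> G) \<union> mp_boundary H E Q) E"
  shows "(behind V E H Q \<inter> G) \<union> mp_boundary H E Q \<in> petals2 G E"
proof -
  let ?C = "behind V E H Q \<inter> G" and ?B = "mp_boundary H E Q"
  have P: "Q \<in> petals H E" using Q petals2_subset by blast
  have QH: "Q \<subseteq> H" using P by (rule petals_subset)
  have int: "mp_interior H E Q \<subseteq> ?C" using behind_Int[OF QH, of V E] G(1) by blast
  have "nbhd E G ?C \<subseteq> nbhd E V (behind V E H Q)" using G(2) by (auto simp: nbhd_def)
  then have nb: "nbhd E G ?C \<subseteq> ?B" using nbhd_behind[OF petals_mp[OF P]] by blast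
  have BH: "?B \<subseteq> H" using mp_boundary_subset QH by fast
  have CB: "?C \<inter> ?B = {}" using behind_Int[OF QH, of V E] BH by (auto simp: mp_interior_def)
  have "?C \<noteq> {}" using int petals_interior[OF P] by blast
  note pI = petalI[OF pr _ this CB petals_boundary[OF P] nb]
  have sub: "?C \<union> ?B \<subseteq> G" using BH G(1) by blast
  obtain u v where uv: "u \<in> mp_interior H E Q" "v \<in> mp_interior H E Q" "u \<noteq> v"
    "\<forall>w\<in>?B. E w u \<and> E w v" by (rule petals2E[OF Q])
  show ?thesis
    using uv(1,2) int pI(2)[OF sub] pI(3)[OF sub]
    by (intro petals2I[OF pI(1)[OF sub] _ _ uv(3) bspec[OF uv(4)]]) auto
qed

text \<open>
  A flower subgraph can have mp-subgraphs that are not mp-subgraphs of \<open>V\<close>: if a petal \<open>M\<close> of a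
  triangle-free graph is bounded by an edge and its end vertices lie in different further
  mp-subgraphs, then this edge becomes an mp-subgraph when the interior of \<open>M\<close> is removed. By the next
  lemma this does not affect petals of Type 2 with nonempty boundary.
\<close>
lemma petals2_clique:
  assumes "Gamma1 V E" "Q \<in> petals2 H E" "pairwise E Q" "mp_boundary H E Q \<noteq> {}"
    and G: "H \<subseteq> G" "G \<subseteq> V" and M: "mp_subgraph G E M" "Q \<subseteq> M"
  shows "M = Q"
proof -
  obtain u v where uv: "u \<in> mp_interior H E Q" "v \<in> mp_interior H E Q" "u \<noteq> v"
    by (rule petals2E[OF assms(2)]) blast
  obtain b where b: "b \<in> mp_boundary H E Q" using assms(4) by blast
  have sub: "{u, v, b} \<subseteq> Q" using uv b by (auto simp: mp_interior_def mp_boundary_def)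
  have "b \<noteq> u" "b \<noteq> v" using uv b by (auto simp: mp_interior_def)
  then have "induces_K E 3 {u, v, b}"
    using uv(3) pairwise_subset[OF assms(3) sub] by (simp add: induces_K_def)
  then have "M = {u, v, b}"
    using Gamma1_triangle[OF Gamma1_subset[OF V assms(1) G(2)] M(1)] sub M(2) by blast
  then show ?thesis using sub M(2) by blast
qed

text \<open>A minimal flower subgraph \<open>G\<close> containing the target set is the target
  itself: a leftover vertex \<open>x\<close> lies in a component \<open>U\<close> of
  \<open>V - H\<close> attached to some \<open>Q\<close> by a clique \<open>K\<close>, and within
  \<open>U \<union> K\<close> there is a petal of \<open>G\<close> whose interior can still be
  removed.\<close>

lemma flower_peel:
  assumes "Gamma1 V E" and D: "D \<subseteq> petals2 H E" "\<And>Q. Q \<in> D \<Longrightarrow> mp_boundary H E Q \<noteq> {}"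
  shows "flower_subgraph V E (V - (\<Union>Q\<in>D. behind V E H Q - Q))"
proof -
  define R where "R = (\<Union>Q\<in>D. behind V E H Q - Q)"
  have DP: "Q \<in> petals H E" if "Q \<in> D" for Q using D(1) that petals2_subset by blast
  have HR: "H \<inter> R = {}"
    unfolding R_def using behind_Int[OF petals_subset[OF DP]] mp_interior_subset by fastforce
  let ?F = "{G. flower_subgraph V E G \<and> V - R \<subseteq> G}"
  have "finite ?F"
    using flower_subset simple_graph_finite[OF V] by (intro finite_subset[of ?F "Pow V"]) auto
  moreover have "V \<in> ?F" by (auto intro: flower_subgraph.refl)
  ultimately have "\<exists>G\<in>?F. G \<subseteq> V \<and> (\<forall>G'\<in>?F. G' \<subseteq> G \<longrightarrow> G = G')"
    by (rule finite_has_minimal2)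
  then obtain G where G: "flower_subgraph V E G" "V - R \<subseteq> G" "G \<subseteq> V"
    and min: "\<forall>G'\<in>?F. G' \<subseteq> G \<longrightarrow> G = G'" by blast
  have HG': "H \<subseteq> G" using HR HV G(2) by blast
  have "G = V - R"
  proof (rule ccontr)
    assume "G \<noteq> V - R"
    then obtain x where x: "x \<in> G" "x \<in> R" using G by blast
    then obtain Q where Q: "Q \<in> D" "x \<in> behind V E H Q" "x \<notin> Q" by (auto simp: R_def)
    note QP = DP[OF Q(1)]
    note QH = petals_subset[OF QP]
    have xH: "x \<in> V - H"
      using Q(2,3) behind_Int[OF QH, of V E] mp_interior_subset[of H E Q] x(1) G(3) by blast
    define U where "U = piece E (V - H) x"
    define K where "K = nbhd E V U"
    have Ux: "x \<in> U" by (simp add: U_def piece_self)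
    have UH: "U \<inter> H = {}" using piece_subset[OF xH, of E] by (auto simp: U_def)
    have Ub: "U \<subseteq> behind V E H Q" using behind_piece[of x Q] Q(2) xH QH by (auto simp: U_def)
    have K: "pairwise E K" using piece_nbhd(1)[OF xH] by (simp add: K_def U_def)
    have "K \<inter> mp_interior H E Q \<noteq> {}" using Q(2) xH mp_interior_subset[of H E Q] QH
      by (auto simp: behind_def K_def U_def)
    then have KQ: "K \<subseteq> Q" using piece_nbhd_petal[OF xH petals_mp[OF QP]] by (simp add: K_def U_def)
    have GG: "simple_graph G E" by (rule simple_graph_subset[OF V G(3)])
    have nG: "nbhd E G (U \<inter> G) \<subseteq> K" using G(3) by (auto simp: nbhd_def K_def)
    have "U \<inter> G \<noteq> {}" using x Ux by blast
    then obtain M where M: "M \<in> petals G E" "M \<subseteq> (U \<inter> G) \<union> nbhd E G (U \<inter> G)" "M \<inter> (U \<inter> G) \<noteq> {}"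
      by (rule petal_behind[OF GG Int_lower2 _ pairwise_subset[OF K nG]])
    \<comment> \<open>Otherwise an interior vertex of \<open>M\<close> lies in \<open>K\<close>,
      hence in \<open>Q\<close>, which forces \<open>Q \<subseteq> M\<close> and then
      \<open>Q \<subseteq> K\<close>. So \<open>Q\<close> is a clique and
      \<open>petals2_clique\<close> gives \<open>M = Q\<close>, although \<open>M\<close> meets
      \<open>U\<close>.\<close>
    have "mp_interior G E M \<inter> (V - R) = {}"
    proof (rule ccontr)
      assume "\<not> ?thesis"
      then obtain k where k: "k \<in> mp_interior G E M" "k \<notin> R" by blast
      have "k \<notin> U"
      proof
        assume "k \<in> U"
        then have "k \<in> behind V E H Q" "k \<notin> Q" using Ub UH QH by auto
        then show False using k(2) Q(1) by (auto simp: R_def)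
      qed
      then have "k \<in> K" using k(1) mp_interior_subset[of G E M] M(2) nG by blast
      then have QM: "Q \<subseteq> M"
        using mp_interior_prime[OF simple_graph_finite[OF GG] k(1) petals_prime[OF QP]] KQ QH HG' by blast
      then have "Q \<subseteq> K" using M(2) nG UH QH by blast
      then have "pairwise E Q" by (rule pairwise_subset[OF K])
      then have "M = Q"
        using petals2_clique[OF assms(1) _ _ D(2)[OF Q(1)] HG' G(3) petals_mp[OF M(1)] QM] Q(1) D(1) by blast
      then show False using M(3) UH QH by blast
    qed
    then have "V - R \<subseteq> G - mp_interior G E M" using G(2) by blast
    moreover have "flower_subgraph V E (G - mp_interior G E M)"
      by (rule flower_subgraph.step[OF G(1) M(1)])
    ultimately have "G = G - mp_interior G E M" using min by blast
    then show False
      using petals_interior[OF M(1)] mp_interior_subset[of G E M] petals_subset[OF M(1)] by blast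
  qed
  then show ?thesis using G(1) by (simp add: R_def)
qed

text \<open>The sets \<open>f Q\<close> of petals of \<open>V\<close> behind the petals
  \<open>Q\<close> of \<open>H\<close> are nonempty and disjoint. Type 2 petals with at least two
  petals behind them are paid for by \<open>card (petals V E)\<close>; the others form
  \<open>D\<close> and give Type 2 petals of the flower subgraph \<open>G\<close>.\<close>

lemma ex_full_flower:
  assumes Gam: "Gamma1 V E"
  shows "\<exists>G. flower_subgraph V E G \<and> card (petals G E) = card (petals V E) \<and>
    card (petals H E) + card (petals2 H E) \<le> card (petals V E) + card (petals2 G E)"
proof -
  let ?C = "behind V E H"
  define f where "f Q = {M \<in> petals V E. M \<inter> ?C Q \<noteq> {}}" for Q
  define D where "D = {Q \<in> petals2 H E. card (f Q) = 1}"
  \<comment> \<open>Only petals with nonempty boundary are peeled. For an empty boundary the set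
    behind \<open>Q\<close> is already a petal of \<open>V\<close> by
    \<open>behind_unique_petal\<close>, and it is left intact.\<close>
  define R where "R = (\<Union>Q\<in>{Q \<in> D. mp_boundary H E Q \<noteq> {}}. ?C Q - Q)"
  define G where "G = V - R"
  have P2: "petals2 H E \<subseteq> petals H E" by (rule petals2_subset)
  have DP: "D \<subseteq> petals H E" using P2 by (auto simp: D_def)
  have finP: "finite (petals X E)" if "X \<subseteq> V" for X
    using that simple_graph_finite[OF V] by (intro finite_petals) (rule finite_subset)
  have finf: "finite (f Q)" for Q using finP[of V] by (simp add: f_def)
  have finD: "finite D" using DP finP[OF HV] by (rule finite_subset)
  have fin2: "finite (petals2 H E)" using P2 finP[OF HV] by (rule finite_subset)
  have fdis: "f Q \<inter> f Q' = {}" if "Q \<in> petals H E" "Q' \<in> petals H E" "Q \<noteq> Q'" for Q Q'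
    using prime_behind_unique[OF that] petals_prime petals_subset by (fastforce simp: f_def)
  have f1: "card (f Q) \<ge> 1" if "Q \<in> petals H E" for Q
  proof -
    have "f Q \<noteq> {}" using ex_petal_behind[OF that HV] by (auto simp: f_def)
    then show ?thesis using finf[of Q] by (simp add: Suc_le_eq card_gt_0_iff)
  qed
  have "card (petals H E) + card (petals2 H E - D) = (\<Sum>Q\<in>petals H E. 1 + (if Q \<in> petals2 H E - D then 1 else 0))"
  proof -
    have "petals H E \<inter> {Q. Q \<in> petals2 H E - D} = petals2 H E - D" using P2 by blast
    then show ?thesis unfolding sum.distrib using finP[OF HV] by (simp add: sum.If_cases)
  qed
  also have "\<dots> \<le> (\<Sum>Q\<in>petals H E. card (f Q))"
  proof (rule sum_mono)
    fix Q assume "Q \<in> petals H E"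
    then show "1 + (if Q \<in> petals2 H E - D then 1 else 0) \<le> card (f Q)"
      using f1[of Q] by (auto simp: D_def)
  qed
  also have "\<dots> = card (\<Union>Q\<in>petals H E. f Q)"
    using fdis finf finP[OF HV] by (intro card_UN_disjoint[symmetric]) auto
  also have "\<dots> \<le> card (petals V E)"
    by (rule card_mono) (auto simp: f_def finP)
  finally have le1: "card (petals H E) + card (petals2 H E - D) \<le> card (petals V E)" .
  have "card (petals2 H E) = card D + card (petals2 H E - D)"
    using card_Un_disjoint[of D "petals2 H E - D"] finD fin2 by (simp add: D_def Un_absorb1)
  with le1 have count: "card (petals H E) + card (petals2 H E) \<le> card (petals V E) + card D" by simp

  have flower: "flower_subgraph V E G"
    unfolding G_def R_def by (rule flower_peel[OF Gam]) (auto simp: D_def)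
  have GV: "G \<subseteq> V" by (simp add: G_def)
  have RH: "R \<inter> H = {}"
  proof -
    have "(?C Q - Q) \<inter> H = {}" if "Q \<in> D" for Q
      using behind_Int[OF petals_subset, of Q H E V] mp_interior_subset[of H E Q] that DP by blast
    then show ?thesis unfolding R_def by blast
  qed
  then have HG': "H \<subseteq> G" using HV by (auto simp: G_def)
  have RC: "R \<subseteq> (\<Union>Q\<in>D. ?C Q)" by (auto simp: R_def)

  have le: "card (petals G E) \<le> card (petals V E)"
    by (rule convex_subgraph.card_petals_le) (simp add: convex_subgraph_def V flower_convex[OF V flower])
  have "\<exists>M. M \<in> petals G E \<and> M \<inter> ?C Q \<noteq> {}" if "Q \<in> D" for Q
  proof -
    have "Q \<in> petals H E" using that DP by blast
    from ex_petal_behind[OF this HG' GV] show ?thesis unfolding Bex_def .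
  qed
  then obtain h where h: "\<And>Q. Q \<in> D \<Longrightarrow> h Q \<in> petals G E \<and> h Q \<inter> ?C Q \<noteq> {}" by metis
  \<comment> \<open>Stated for an arbitrary choice function since it serves twice: for
    \<open>h\<close>, which counts petals of \<open>G\<close>, and for the \<open>k\<close> defined
    below, which counts those of Type 2.\<close>
  have inj: "inj_on k D" if k: "\<And>Q. Q \<in> D \<Longrightarrow> k Q \<in> petals G E \<and> k Q \<inter> ?C Q \<noteq> {}" for k
  proof (rule inj_onI, rule ccontr)
    fix Q Q' assume Q: "Q \<in> D" "Q' \<in> D" "k Q = k Q'" "Q \<noteq> Q'"
    have p: "prime_graph (k Q) E" "k Q \<subseteq> V" using k[OF Q(1)] GV by (auto dest: petals_prime petals_subset)
    have "Q \<in> petals H E" "Q' \<in> petals H E" using Q DP by auto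
    then show False using prime_behind_unique[OF _ _ Q(4) p] k[OF Q(1)] k[OF Q(2)] Q(3) by simp
  qed
  \<comment> \<open>Petals of \<open>V\<close> behind no member of \<open>D\<close> survive in
    \<open>G\<close>. Each member of \<open>D\<close> has exactly one petal of \<open>V\<close> and
    at least one petal of \<open>G\<close> behind it, so the number of petals does not drop.\<close>
  define A where "A = {M \<in> petals V E. \<forall>Q\<in>D. M \<inter> ?C Q = {}}"
  have AG: "A \<subseteq> petals G E"
  proof
    fix M assume M: "M \<in> A"
    then have "M \<subseteq> V" by (auto simp: A_def dest: petals_subset)
    moreover have "M \<inter> R = {}" using M RC by (auto simp: A_def)
    ultimately show "M \<in> petals G E"
      using M by (intro petals_transfer[OF V _ _ GV]) (auto simp: A_def G_def)
  qed
  have Ah: "A \<inter> h ` D = {}" using h by (auto simp: A_def)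
  have "card (petals V E) \<le> card (A \<union> (\<Union>Q\<in>D. f Q))"
    using finP[of V] finD finf by (intro card_mono) (auto simp: A_def f_def)
  also have "\<dots> \<le> card A + card (\<Union>Q\<in>D. f Q)" by (rule card_Un_le)
  also have "card (\<Union>Q\<in>D. f Q) \<le> (\<Sum>Q\<in>D. card (f Q))" by (rule card_UN_le[OF finD])
  also have "\<dots> = card D" by (simp add: D_def)
  also have "card D = card (h ` D)" by (rule card_image[OF inj[OF h], symmetric])
  also have "card A + card (h ` D) = card (A \<union> h ` D)"
    using Ah finD finP[OF GV] AG by (intro card_Un_disjoint[symmetric]) (auto intro: finite_subset)
  also have "\<dots> \<le> card (petals G E)"
    using AG h by (intro card_mono finP[OF GV]) auto
  finally have ge: "card (petals V E) \<le> card (petals G E)" by simp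

  \<comment> \<open>This is \<open>Q\<close> itself if its boundary is nonempty, and otherwise the
    unique petal of \<open>V\<close> behind \<open>Q\<close>.\<close>
  define k where "k Q = (?C Q \<inter> G) \<union> mp_boundary H E Q" for Q
  have k2: "k Q \<in> petals2 G E" if Q: "Q \<in> D" for Q
    unfolding k_def
  proof (rule petals2_behind[OF _ HG' GV])
    show "Q \<in> petals2 H E" using Q by (simp add: D_def)
    have QP: "Q \<in> petals H E" using Q DP by blast
    note QH = petals_subset[OF QP]
    show "prime_graph ((?C Q \<inter> G) \<union> mp_boundary H E Q) E"
    proof (cases "mp_boundary H E Q = {}")
      case True
      have "card (f Q) = 1" using Q by (simp add: D_def)
      then obtain M where M: "f Q = {M}" by (auto simp: card_1_singleton_iff)
      then have CM: "?C Q = M" using behind_unique_petal[OF QP True] by (simp add: f_def)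
      have "M \<in> petals V E" using M by (auto simp: f_def)
      moreover have "?C Q \<inter> R = {}"
      proof -
        have "?C Q \<inter> ?C Q' = {}" if "Q' \<in> D" "mp_boundary H E Q' \<noteq> {}" for Q'
          using that DP True QP by (intro behind_disjoint petals_mp) auto
        then show ?thesis unfolding R_def by blast
      qed
      then have "?C Q \<subseteq> G" using behind_subset[OF HV QH] by (auto simp: G_def)
      ultimately show ?thesis using True CM petals_prime by (simp add: Int_absorb2)
    next
      case False
      then have "?C Q - Q \<subseteq> R" using Q unfolding R_def by blast
      then have "?C Q \<inter> G \<subseteq> Q" by (auto simp: G_def)
      moreover have "mp_interior H E Q \<subseteq> ?C Q \<inter> G" using behind_Int[OF QH, of V E] HG' by blast
      ultimately have "(?C Q \<inter> G) \<union> mp_boundary H E Q = Q"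
        using mp_decomp[of Q H E] mp_boundary_subset[of H E Q] by blast
      then show ?thesis using petals_prime[OF QP] by simp
    qed
  qed
  have "inj_on k D"
  proof (rule inj)
    fix Q assume Q: "Q \<in> D"
    then have QP: "Q \<in> petals H E" using DP by blast
    have "mp_interior H E Q \<subseteq> ?C Q \<inter> G" using behind_Int[OF petals_subset[OF QP], of V E] HG' by blast
    then have "k Q \<inter> ?C Q \<noteq> {}" using petals_interior[OF QP] by (auto simp: k_def)
    then show "k Q \<in> petals G E \<and> k Q \<inter> ?C Q \<noteq> {}" using k2[OF Q] petals2_subset by blast
  qed
  then have "card D \<le> card (petals2 G E)"
    using k2 finite_subset[OF petals2_subset finP[OF GV]] by (intro card_inj_on_le[of k]) auto
  then show ?thesis using flower le ge count by (intro exI[of _ G]) auto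
qed

end

section \<open>Unions of components\<close>

lemma separated_Compl:
  assumes "simple_graph V E" "nbhd E V Z = {}"
  shows "nbhd E V (V - Z) = {}"
proof (rule ccontr)
  assume "\<not> ?thesis"
  then obtain x y where xy: "y \<in> V" "y \<in> Z" "x \<in> V" "x \<notin> Z" "E x y" by (auto simp: nbhd_def)
  then have "E y x" using simple_graph_sym[OF assms(1)] by blast
  then have "x \<in> nbhd E V Z" using xy by (auto simp: nbhd_def)
  then show False using assms(2) by simp
qed

text \<open>\<open>Z\<close> is a union of components of \<open>V\<close>. A prime set meeting
  \<open>Z\<close> lies in it, so the petals of a subgraph \<open>A\<close> that meet
  \<open>Z\<close>, with their boundaries and types, are determined by
  \<open>A \<inter> Z\<close>.\<close>

locale separated_part =
  fixes V :: "'a set" and E Z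
  assumes V: "simple_graph V E" and ZV: "Z \<subseteq> V" and Z: "nbhd E V Z = {}"
begin

lemma prime_part: "prime_graph N E \<Longrightarrow> N \<subseteq> V \<Longrightarrow> N \<inter> Z \<noteq> {} \<Longrightarrow> N \<subseteq> Z"
  using prime_graph_side[of N E V Z "{}"] Z by simp

lemma mp_part:
  assumes "A \<subseteq> V" "B \<subseteq> V" "A \<inter> Z = B \<inter> Z" "M \<inter> Z \<noteq> {}" "mp_subgraph A E M"
  shows "mp_subgraph B E M"
proof -
  have MA: "M \<subseteq> A" and pr: "prime_graph M E"
    using assms(5) by (auto dest: mp_subgraph_subset mp_subgraph_prime)
  then have "M \<subseteq> Z" using prime_part assms(1,4) by blast
  then have MB: "M \<subseteq> B" using MA assms(3) by blast
  have "\<not> prime_graph N E" if N: "M \<subset> N" "N \<subseteq> B" for N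
  proof
    assume p: "prime_graph N E"
    then have "N \<subseteq> Z" using prime_part[of N] N assms(2,4) by blast
    then have "N \<subseteq> A" using N assms(3) by blast
    then show False using mp_subgraph_maximal[OF assms(5) p] N by blast
  qed
  then show ?thesis using pr MB by (simp add: mp_subgraph_def)
qed

context
  fixes A B
  assumes A: "A \<subseteq> V" and B: "B \<subseteq> V" and AB: "A \<inter> Z = B \<inter> Z"
begin

lemma mp_part_iff: "M \<inter> Z \<noteq> {} \<Longrightarrow> mp_subgraph A E M \<longleftrightarrow> mp_subgraph B E M"
  using mp_part[OF A B AB] mp_part[OF B A AB[symmetric]] by blast

lemma boundary_part:
  assumes "M \<inter> Z \<noteq> {}" "mp_subgraph A E M"
  shows "mp_boundary A E M = mp_boundary B E M"
proof -
  have "M \<subseteq> Z"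
    using prime_part[OF mp_subgraph_prime[OF assms(2)]] mp_subgraph_subset[OF assms(2)] A assms(1) by blast
  then have "v \<in> M \<Longrightarrow> mp_subgraph A E N \<and> N \<noteq> M \<and> v \<in> N \<longleftrightarrow> mp_subgraph B E N \<and> N \<noteq> M \<and> v \<in> N" for v N
    using mp_part_iff[of N] by blast
  then show ?thesis unfolding mp_boundary_def by blast
qed

lemma interior_part:
  assumes "M \<inter> Z \<noteq> {}" "mp_subgraph A E M"
  shows "mp_interior A E M = mp_interior B E M"
  using boundary_part[OF assms] by (simp add: mp_interior_def)

lemma petals_part:
  assumes "M \<inter> Z \<noteq> {}"
  shows "M \<in> petals A E \<longleftrightarrow> M \<in> petals B E"
proof (cases "mp_subgraph A E M")
  case True
  then show ?thesis
    using boundary_part[OF assms True] interior_part[OF assms True] mp_part_iff[OF assms]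
    by (simp add: petals_def)
next
  case False
  then show ?thesis using mp_part_iff[OF assms] by (simp add: petals_def)
qed

lemma petals2_part:
  assumes "M \<inter> Z \<noteq> {}"
  shows "M \<in> petals2 A E \<longleftrightarrow> M \<in> petals2 B E"
proof (cases "mp_subgraph A E M")
  case True
  then show ?thesis
    using boundary_part[OF assms True] interior_part[OF assms True] petals_part[OF assms]
    by (simp add: petals2_def stamen_set2_def)
next
  case False
  then show ?thesis using petals_part[OF assms] by (auto simp: petals2_def dest: petals_mp)
qed

end

text \<open>The construction of \<open>W\<close> is replayed, skipping every removal that belongs to
  a petal not meeting \<open>Z\<close>.\<close>

lemma flower_part:
  assumes "flower_subgraph V E W"
  shows "flower_subgraph V E ((V - Z) \<union> (W \<inter> Z))"
  using assms
proof (induction rule: flower_subgraph.induct)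
  case refl
  have "(V - Z) \<union> (V \<inter> Z) = V" by blast
  then show ?case by (simp add: flower_subgraph.refl)
next
  case (step W M)
  let ?W = "(V - Z) \<union> (W \<inter> Z)"
  have WV: "W \<subseteq> V" using step(1) by (rule flower_subset)
  have MW: "M \<subseteq> W" by (rule petals_subset[OF step(2)])
  show ?case
  proof (cases "M \<inter> Z = {}")
    case True
    then have "(V - Z) \<union> ((W - mp_interior W E M) \<inter> Z) = ?W" using mp_interior_subset[of W E M] by blast
    then show ?thesis using step(3) by simp
  next
    case False
    have eq: "W \<inter> Z = ?W \<inter> Z" by blast
    have W'V: "?W \<subseteq> V" using ZV by blast
    have "M \<in> petals ?W E" using petals_part[OF WV W'V eq False] step(2) by simp
    then have "flower_subgraph V E (?W - mp_interior ?W E M)" by (rule flower_subgraph.step[OF step(3)])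
    moreover have "mp_interior ?W E M = mp_interior W E M"
      using interior_part[OF WV W'V eq False petals_mp[OF step(2)]] by simp
    moreover have "M \<subseteq> Z" using prime_part[OF petals_prime[OF step(2)]] MW WV False by blast
    then have "(V - Z) \<union> ((W - mp_interior W E M) \<inter> Z) = ?W - mp_interior W E M"
      using mp_interior_subset[of W E M] by blast
    ultimately show ?thesis by simp
  qed
qed

end

section \<open>Stamen sets and the lower bound\<close>

text \<open>One stamen set is chosen in each petal, with two vertices exactly for Type 2. Every
  chosen vertex is cut off from the others by a clique, and \<open>convex_diff\<close> turns this
  into a certificate of independence.\<close>

lemma ex_stamens:
  assumes G: "simple_graph W E"
  shows "\<exists>S. monophonically_independent W E S \<and> card S = card (petals W E) + card (petals2 W E)"
proof -
  let ?P = "petals W E"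
  let ?I = "mp_interior W E" and ?B = "mp_boundary W E"
  have fin: "finite ?P" using G by (simp add: finite_petals simple_graph_finite)
  \<comment> \<open>The last clause is void for a singleton. For two vertices, read in both orders,
    it joins each of them to the whole boundary.\<close>
  define good where "good M X \<longleftrightarrow> X \<subseteq> ?I M \<and> card X = (if M \<in> petals2 W E then 2 else 1) \<and>
      (\<forall>s\<in>X. \<forall>t\<in>X. s \<noteq> t \<longrightarrow> X = {s, t} \<and> (\<forall>w\<in>?B M. E w t))" for M X
  have "\<exists>X. good M X" if M: "M \<in> ?P" for M
  proof (cases "M \<in> petals2 W E")
    case True
    obtain u v where "u \<in> ?I M" "v \<in> ?I M" "u \<noteq> v" "\<forall>w\<in>?B M. E w u \<and> E w v"
      by (rule petals2E[OF True])
    then show ?thesis using True by (intro exI[of _ "{u, v}"]) (auto simp: good_def)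
  next
    case False
    obtain u where "u \<in> ?I M" using petals_interior[OF M] by blast
    then show ?thesis using False by (intro exI[of _ "{u}"]) (auto simp: good_def)
  qed
  then obtain X where good: "\<And>M. M \<in> ?P \<Longrightarrow> good M (X M)" by metis
  have X: "X M \<subseteq> ?I M" and cX: "card (X M) = (if M \<in> petals2 W E then 2 else 1)" if "M \<in> ?P" for M
    using good[OF that] by (auto simp: good_def)
  have adj: "X M = {s, t} \<and> (\<forall>w\<in>?B M. E w t)" if "M \<in> ?P" "s \<in> X M" "t \<in> X M" "s \<noteq> t" for M s t
    using good[OF that(1)] that(2-4) unfolding good_def by blast
  have IW: "?I M \<subseteq> W" if "M \<in> ?P" for M using petals_subset[OF that] mp_interior_subset by fast
  have BW: "?B M \<subseteq> W" if "M \<in> ?P" for M using petals_subset[OF that] mp_boundary_subset by fast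
  have dis: "?I M \<inter> ?I N = {}" if "M \<in> ?P" "N \<in> ?P" "M \<noteq> N" for M N
    by (rule petals_interior_disjoint[OF that])
  have finX: "finite (X M)" if "M \<in> ?P" for M
    using X[OF that] IW[OF that] simple_graph_finite[OF G] by (meson finite_subset)
  define S where "S = (\<Union>M\<in>?P. X M)"
  have "card S = (\<Sum>M\<in>?P. card (X M))"
    unfolding S_def using fin finX
  proof (intro card_UN_disjoint ballI impI)
    fix M N assume MN: "M \<in> ?P" "N \<in> ?P" "M \<noteq> N"
    show "X M \<inter> X N = {}" using dis[OF MN] X[OF MN(1)] X[OF MN(2)] by blast
  qed
  also have "\<dots> = (\<Sum>M\<in>?P. 1 + (if M \<in> petals2 W E then 1 else 0))"
    using cX by (intro sum.cong) auto
  also have "\<dots> = card ?P + card (?P \<inter> petals2 W E)"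
    unfolding sum.distrib using fin by (simp add: sum.If_cases Int_def)
  also have "?P \<inter> petals2 W E = petals2 W E" using petals2_subset by blast
  finally have card: "card S = card ?P + card (petals2 W E)" .
  have "monophonically_independent W E S"
  proof (rule independentI)
    show "S \<subseteq> W" unfolding S_def using X IW by blast
    fix s assume "s \<in> S"
    then obtain M where M: "M \<in> ?P" "s \<in> X M" by (auto simp: S_def)
    \<comment> \<open>The part to be cut off: the interior without the other stamen vertex, if there
      is one. Of two stamen vertices \<open>K\<close> contains only one, so \<open>K\<close> is a
      clique even if they are not adjacent.\<close>
    define C where "C = ?I M - (X M - {s})"
    define K where "K = ?B M \<union> (X M - {s})"
    have XI: "X M \<subseteq> ?I M" by (rule X[OF M(1)])
    have CW: "C \<subseteq> W" using IW[OF M(1)] by (auto simp: C_def)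
    have nb: "nbhd E W C \<subseteq> K"
    proof
      fix y assume "y \<in> nbhd E W C"
      then obtain x where "y \<in> W" "y \<notin> C" "x \<in> C" "E x y" by (auto simp: nbhd_def)
      moreover from this have "y \<in> M"
        using mp_interior_edge[OF G _ petals_mp[OF M(1)], of x y] by (auto simp: C_def)
      ultimately show "y \<in> K" by (auto simp: C_def K_def mp_interior_def)
    qed
    have "pairwise E K"
      unfolding pairwise_def
    proof (intro ballI impI)
      fix x y assume xy: "x \<in> K" "y \<in> K" "x \<noteq> y"
      have *: "E w t \<and> E t w" if "w \<in> ?B M" "t \<in> X M - {s}" for w t
      proof -
        have "E w t" using adj[OF M, of t] that by blast
        moreover have "w \<in> W" "t \<in> W" using BW[OF M(1)] IW[OF M(1)] XI that by blast+
        ultimately show ?thesis using simple_graph_sym[OF G] by blast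
      qed
      show "E x y"
      proof (cases "x \<in> X M - {s}")
        case True
        then have "X M = {s, x}" using adj[OF M, of x] by blast
        then have "y \<in> ?B M" using xy by (auto simp: K_def)
        then show ?thesis using * True by blast
      next
        case False
        then have "x \<in> ?B M" using xy by (auto simp: K_def)
        then show ?thesis using * petals_boundary[OF M(1)] xy by (auto simp: K_def pairwise_def)
      qed
    qed
    then have "pairwise E (nbhd E W C)" using nb by (rule pairwise_subset)
    then have "monophonically_convex W E (W - C)" by (rule convex_diff[OF G CW])
    moreover have "S - {s} \<subseteq> W - C"
    proof
      fix t assume t: "t \<in> S - {s}"
      then obtain N where N: "N \<in> ?P" "t \<in> X N" by (auto simp: S_def)
      have "t \<notin> C"
      proof (cases "N = M")
        case True
        then show ?thesis using N t by (auto simp: C_def)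
      next
        case False
        then show ?thesis using dis[OF N(1) M(1)] X[OF N(1)] N(2) by (auto simp: C_def)
      qed
      then show "t \<in> W - C" using X[OF N(1)] IW[OF N(1)] N(2) by blast
    qed
    moreover have "s \<notin> W - C" using M(2) XI by (auto simp: C_def)
    ultimately show "\<exists>T. monophonically_convex W E T \<and> S - {s} \<subseteq> T \<and> s \<notin> T" by blast
  qed
  then show ?thesis using card by blast
qed

section \<open>Components of a graph\<close>

lemma component_subset: "component V E X \<Longrightarrow> X \<subseteq> V"
  and component_connected: "component V E X \<Longrightarrow> connected_graph X E"
  by (auto simp: component_def)

lemma component_nbhd:
  assumes G: "simple_graph V E" and X: "component V E X"
  shows "nbhd E V X = {}"
proof (rule ccontr)
  assume "nbhd E V X \<noteq> {}"
  then obtain x y where xy: "y \<in> V" "y \<notin> X" "x \<in> X" "E x y" by (auto simp: nbhd_def)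
  have Eyx: "E y x" using simple_graph_sym[OF G _ xy(1,4)] xy(3) component_subset[OF X] by blast
  have "connected_graph (insert y X) E"
    unfolding connected_graph_iff
  proof (intro allI impI, elim conjE)
    fix A assume A: "A \<subseteq> insert y X" "A \<noteq> {}" "nbhd E (insert y X) A = {}"
    have closed: "b \<in> A" if "a \<in> A" "E a b" "b \<in> insert y X" for a b
      using A(3) that unfolding nbhd_def by blast
    have "A \<inter> X \<noteq> {}" using A(1,2) closed[of y x] Eyx xy(3) by blast
    moreover have "nbhd E X (A \<inter> X) = {}" using closed by (auto simp: nbhd_def)
    ultimately have "A \<inter> X = X"
      using component_connected[OF X] unfolding connected_graph_iff by blast
    then show "A = insert y X" using closed[of x y] xy A(1) by blast
  qed
  then show False using X xy(1,2) unfolding component_def by blast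
qed

lemma component_eq:
  assumes G: "simple_graph V E" and X: "component V E X" "component V E X'" "X \<inter> X' \<noteq> {}"
  shows "X = X'"
proof -
  have "A \<subseteq> B" if AB: "component V E A" "component V E B" "A \<inter> B \<noteq> {}" for A B
  proof -
    have "nbhd E A (A \<inter> B) \<subseteq> nbhd E V B" using component_subset[OF AB(1)] by (auto simp: nbhd_def)
    then have "nbhd E A (A \<inter> B) = {}" using component_nbhd[OF G AB(2)] by blast
    then have "A \<inter> B = A" using component_connected[OF AB(1)] AB(3) unfolding connected_graph_iff by blast
    then show ?thesis by blast
  qed
  from this[OF X] this[OF X(2,1)] X(3) show ?thesis by blast
qed

lemma ex_component:
  assumes G: "simple_graph V E" and x: "x \<in> V"
  obtains X where "component V E X" "x \<in> X"
proof -
  let ?F = "{X. X \<subseteq> V \<and> connected_graph X E}"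
  have "finite ?F" using simple_graph_finite[OF G] by (intro finite_subset[of ?F "Pow V"]) auto
  moreover have "{x} \<in> ?F" using x by (auto simp: connected_graph_def)
  ultimately have "\<exists>X\<in>?F. {x} \<subseteq> X \<and> (\<forall>Y\<in>?F. X \<subseteq> Y \<longrightarrow> X = Y)" by (rule finite_has_maximal2)
  then obtain X where "X \<in> ?F" "x \<in> X" "\<forall>Y\<in>?F. X \<subseteq> Y \<longrightarrow> X = Y" by blast
  then show thesis by (intro that[of X]) (auto simp: component_def)
qed

text \<open>By convexity an induced path in \<open>X\<close> between two vertices of
  \<open>H\<close> stays in \<open>H\<close>, and such a path starting in \<open>M\<close> cannot
  leave \<open>M\<close>.\<close>

lemma convex_component_closed:
  assumes G: "simple_graph V E" and H: "monophonically_convex V E H" and X: "component V E X"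
    and M: "M \<subseteq> H" "M \<inter> X \<noteq> {}" "nbhd E H M = {}"
  shows "H \<inter> X \<subseteq> M"
proof
  fix y assume y: "y \<in> H \<inter> X"
  obtain m where m: "m \<in> M" "m \<in> X" using M(2) by blast
  have "walk E X m y" using component_connected[OF X] m y by (simp add: connected_graph_def)
  then obtain p where p: "induced_path X E p" "hd p = m" "last p = y"
    using m(2) by (rule walk_induced_path)
  have pH: "set p \<subseteq> H"
    using convex_path[OF H induced_path_mono[OF p(1) component_subset[OF X]]] p M(1) m y by auto
  have "i < length p \<Longrightarrow> p ! i \<in> M" for i
  proof (induction i)
    case 0
    then show ?case using p(1,2) m(1) by (simp add: induced_path_def hd_conv_nth)
  next
    case (Suc i)
    have "E (p ! i) (p ! Suc i)" using p(1) Suc(2) by (simp add: induced_path_def)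
    moreover have "p ! i \<in> M" using Suc by simp
    moreover have "p ! Suc i \<in> H" using pH Suc(2) by auto
    ultimately show ?case using M(3) unfolding nbhd_def by blast
  qed
  moreover have "p \<noteq> []" using p(1) by (simp add: induced_path_def)
  ultimately show "y \<in> M" using p(3) by (metis last_conv_nth diff_less length_greater_0_conv less_one)
qed

section \<open>The upper bound\<close>

text \<open>\<open>Z\<close> collects the components where \<open>S\<close> is a triangle. Off
  \<open>Z\<close>, a flower subgraph is shrunk until \<open>S\<close> meets every petal interior,
  and then in at most two vertices. This is glued with \<open>W\<close> on \<open>Z\<close> to a
  flower subgraph \<open>H\<close>; \<open>ex_full_flower\<close> replaces \<open>H\<close> by some
  \<open>F\<close> to which the maximality of \<open>W\<close> applies.\<close>

lemma independent_card_bound: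
  fixes V :: "'a set" and E :: "'a \<Rightarrow> 'a \<Rightarrow> bool" and W :: "'a set"
  assumes G: "simple_graph V E" and Gam: "Gamma1 V E" and W: "flower_subgraph V E W"
    and max: "\<And>H. \<lbrakk>flower_subgraph V E H; card (petals H E) = card (petals V E)\<rbrakk>
           \<Longrightarrow> card (petals2 H E) \<le> card (petals2 W E)"
    and tri: "triangles_accounted V E W" and S: "monophonically_independent V E S"
  shows "card S \<le> card (petals V E) + card (petals2 W E)"
proof -
  define XS where "XS = {X. component V E X \<and> induces_K E 3 (S \<inter> X)}"
  define Z where "Z = \<Union>XS"
  have finV: "finite V" by (rule simple_graph_finite[OF G])
  have SV: "S \<subseteq> V" using S by (simp add: monophonically_independent_def)
  have finS: "finite S" using SV finV by (rule finite_subset)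
  have XSV: "X \<subseteq> V" if "X \<in> XS" for X using that component_subset by (auto simp: XS_def)
  have finXS: "finite XS" using XSV finV by (intro finite_subset[of XS "Pow V"]) auto
  have ZV: "Z \<subseteq> V" using XSV by (auto simp: Z_def)
  have "nbhd E V Z \<subseteq> (\<Union>X\<in>XS. nbhd E V X)" by (auto simp: Z_def nbhd_def)
  then have Znb: "nbhd E V Z = {}" using component_nbhd[OF G] by (auto simp: XS_def)
  interpret Z: separated_part V E Z by standard (use G ZV Znb in auto)
  interpret Z': separated_part V E "V - Z" by standard (use G separated_Compl[OF G Znb] in auto)

  \<comment> \<open>Inside the components where \<open>S\<close> is a triangle, \<open>W\<close> itself does
    at least as well as \<open>S\<close>, by \<open>triangles_accounted\<close>.\<close>
  let ?F = "{H. flower_subgraph V E H \<and> H \<inter> Z = W \<inter> Z \<and> S - Z \<subseteq> H}"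
  have "finite ?F"
    using flower_subset finV by (intro finite_subset[of ?F "Pow V"]) auto
  moreover have "(V - Z) \<union> (W \<inter> Z) \<in> ?F" using Z.flower_part[OF W] SV by blast
  ultimately have "\<exists>H\<in>?F. H \<subseteq> (V - Z) \<union> (W \<inter> Z) \<and> (\<forall>H'\<in>?F. H' \<subseteq> H \<longrightarrow> H = H')"
    by (rule finite_has_minimal2)
  then obtain H where HF: "H \<in> ?F" and min: "\<forall>H'\<in>?F. H' \<subseteq> H \<longrightarrow> H = H'" by (elim bexE conjE)
  then have H: "flower_subgraph V E H" "H \<inter> Z = W \<inter> Z" "S - Z \<subseteq> H" by simp_all
  have HV: "H \<subseteq> V" and WV: "W \<subseteq> V" using H(1) W by (auto dest: flower_subset)
  have convH: "monophonically_convex V E H" by (rule flower_convex[OF G H(1)])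
  define H0 where "H0 = H - Z"
  define S0 where "S0 = S - Z"
  have H0V: "H0 \<subseteq> V" using HV by (auto simp: H0_def)
  have G0: "simple_graph H0 E" by (rule simple_graph_subset[OF G H0V])
  have conv0: "monophonically_convex V E H0"
  proof -
    have "H0 = H \<inter> (V - Z)" using HV by (auto simp: H0_def)
    moreover have "monophonically_convex V E (V - Z)" using convex_diff[OF G ZV] Znb by simp
    ultimately show ?thesis using convex_Int[OF convH] by simp
  qed
  have ind0: "monophonically_independent H0 E S0"
    using H(3) by (intro independent_sub[OF S _ _ H0V]) (auto simp: S0_def H0_def)
  have H0eq: "H0 \<inter> (V - Z) = H \<inter> (V - Z)" by (auto simp: H0_def)
  have meet0: "M \<inter> (V - Z) \<noteq> {}" if "M \<in> petals H0 E" for M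
    using petals_interior[OF that] mp_interior_subset[of H0 E M] petals_subset[OF that] HV by (auto simp: H0_def)
  \<comment> \<open>A petal of \<open>H0\<close> whose interior \<open>S0\<close> misses is a petal
    of \<open>H\<close> whose interior could be removed, against the minimality of
    \<open>H\<close>.\<close>
  have hits: "S0 \<inter> mp_interior H0 E M \<noteq> {}" if M: "M \<in> petals H0 E" for M
  proof
    assume e: "S0 \<inter> mp_interior H0 E M = {}"
    have MH: "M \<in> petals H E" using Z'.petals_part[OF H0V HV H0eq meet0[OF M]] M by simp
    have int: "mp_interior H0 E M = mp_interior H E M"
      by (rule Z'.interior_part[OF H0V HV H0eq meet0[OF M] petals_mp[OF M]])
    have "mp_interior H E M \<subseteq> H0" using mp_interior_subset[of H E M] petals_subset[OF M] by blast
    then have mem: "H - mp_interior H E M \<in> ?F"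
      using flower_subgraph.step[OF H(1) MH] H(2,3) e int by (auto simp: H0_def S0_def)
    have "H = H - mp_interior H E M" using bspec[OF min mem] Diff_subset by (rule mp)
    then show False
      using petals_interior[OF MH] mp_interior_subset[of H E M] petals_subset[OF MH] by blast
  qed
  \<comment> \<open>Three vertices of \<open>S\<close> in one interior form a triangle, so
    \<open>M\<close> is this triangle and has empty boundary. Convexity of \<open>H0\<close> makes
    \<open>M\<close> all of \<open>H0 \<inter> X\<close>, hence all of \<open>S \<inter> X\<close>,
    for its component \<open>X\<close>. So \<open>X\<close> belongs to \<open>XS\<close>, although
    \<open>H0\<close> avoids \<open>Z\<close>.\<close>
  have le2: "card (S0 \<inter> mp_interior H0 E M) \<le> 2" if M: "M \<in> petals H0 E" for M
  proof (rule ccontr)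
    let ?X = "S0 \<inter> mp_interior H0 E M"
    assume "\<not> card ?X \<le> 2"
    then have c3: "card ?X \<ge> 3" by simp
    have cl: "pairwise E (mp_boundary H0 E M \<union> ?X)"
      by (rule independent_petal_cases(3)[OF G0 ind0 hits M c3])
    obtain Y where Y: "Y \<subseteq> ?X" "card Y = 3" "finite Y" using obtain_subset_with_card_n[OF c3] by metis
    have "pairwise E Y" using cl Y(1) by (rule pairwise_subset[OF _ le_supI2])
    then have K: "induces_K E 3 Y" using Y by (simp add: induces_K_def)
    have YM: "Y \<subseteq> M" using Y(1) mp_interior_subset[of H0 E M] by blast
    have MY: "M = Y"
      by (rule Gamma1_triangle[OF Gamma1_subset[OF G Gam H0V] petals_mp[OF M] YM K])
    then have MI: "mp_interior H0 E M = M" and MS: "M \<subseteq> S0"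
      using Y(1) mp_interior_subset[of H0 E M] by blast+
    then have "mp_boundary H0 E M = {}" using mp_boundary_subset[of H0 E M] by (auto simp: mp_interior_def)
    then have nb: "nbhd E H0 M = {}" using nbhd_mp_interior[OF G0 petals_mp[OF M]] MI by simp
    obtain m where m: "m \<in> M" using petals_interior[OF M] mp_interior_subset[of H0 E M] by blast
    have MH0: "M \<subseteq> H0" by (rule petals_subset[OF M])
    obtain X where X: "component V E X" "m \<in> X" using ex_component[OF G] m MH0 H0V by blast
    have XM: "H0 \<inter> X \<subseteq> M" using convex_component_closed[OF G conv0 X(1) MH0 _ nb] m X(2) by blast
    have XZ: "X \<inter> Z = {}"
    proof (rule ccontr)
      assume "X \<inter> Z \<noteq> {}"
      then obtain X' where X': "X' \<in> XS" "X \<inter> X' \<noteq> {}" by (auto simp: Z_def)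
      then have "X = X'" using component_eq[OF G X(1)] by (auto simp: XS_def)
      then show False using X' X(2) m MH0 by (auto simp: Z_def H0_def)
    qed
    interpret X: separated_part V E X
      by standard (use G component_subset[OF X(1)] component_nbhd[OF G X(1)] in auto)
    have "M \<subseteq> X" using X.prime_part[OF petals_prime[OF M]] MH0 H0V m X(2) by blast
    moreover have "S \<inter> X \<subseteq> H0" using XZ H(3) by (auto simp: H0_def)
    ultimately have "S \<inter> X = M" using XM MS by (auto simp: S0_def)
    then have "X \<in> XS" using X(1) K MY by (simp add: XS_def)
    then show False using XZ X(2) by (auto simp: Z_def)
  qed
  have S0: "card S0 \<le> card (petals H0 E) + card (petals2 H0 E)"
    by (rule independent_card_le[OF G0 ind0 hits le2])

  define PZ where "PZ = {M \<in> petals1 W E. M \<inter> Z \<noteq> {}}"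
  define PZ2 where "PZ2 = {M \<in> petals2 W E. M \<inter> Z \<noteq> {}}"
  have finW: "finite (petals W E)" using finV WV by (intro finite_petals) (rule finite_subset)
  have finH: "finite (petals H E)" using finV HV by (intro finite_petals) (rule finite_subset)
  have finPZ: "finite PZ" "finite PZ2"
    using petals2_subset[of W E]
    by (auto simp: PZ_def PZ2_def petals1_def intro!: finite_subset[OF _ finW])
  have XSdis: "X \<inter> X' = {}" if "X \<in> XS" "X' \<in> XS" "X \<noteq> X'" for X X'
    using component_eq[OF G, of X X'] that by (auto simp: XS_def)
  have ne: "M \<noteq> {}" if "M \<in> petals W E" for M
    using petals_interior[OF that] mp_interior_subset[of W E M] by blast
  have part: "(\<Sum>X\<in>XS. card {M \<in> P. M \<subseteq> X}) \<le> card {M \<in> P. M \<inter> Z \<noteq> {}}" if P: "P \<subseteq> petals W E" for P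
  proof -
    have fP: "finite P" using P finW by (rule finite_subset)
    have "(\<Sum>X\<in>XS. card {M \<in> P. M \<subseteq> X}) = card (\<Union>X\<in>XS. {M \<in> P. M \<subseteq> X})"
    proof (rule card_UN_disjoint[symmetric, OF finXS])
      show "\<forall>X\<in>XS. finite {M \<in> P. M \<subseteq> X}" using fP by simp
      show "\<forall>X\<in>XS. \<forall>X'\<in>XS. X \<noteq> X' \<longrightarrow> {M \<in> P. M \<subseteq> X} \<inter> {M \<in> P. M \<subseteq> X'} = {}"
      proof (intro ballI impI)
        fix X X' assume "X \<in> XS" "X' \<in> XS" "X \<noteq> X'"
        then have d: "X \<inter> X' = {}" by (rule XSdis)
        have "M \<noteq> {}" if "M \<in> P" for M using ne P that by (metis subsetD)
        then show "{M \<in> P. M \<subseteq> X} \<inter> {M \<in> P. M \<subseteq> X'} = {}" using d by auto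
      qed
    qed
    also have "\<dots> \<le> card {M \<in> P. M \<inter> Z \<noteq> {}}"
    proof (rule card_mono)
      show "(\<Union>X\<in>XS. {M \<in> P. M \<subseteq> X}) \<subseteq> {M \<in> P. M \<inter> Z \<noteq> {}}"
      proof
        fix M assume "M \<in> (\<Union>X\<in>XS. {M \<in> P. M \<subseteq> X})"
        then have M: "M \<in> P" "M \<subseteq> Z" by (auto simp: Z_def)
        then have "M \<noteq> {}" using ne P by (metis subsetD)
        then show "M \<in> {M \<in> P. M \<inter> Z \<noteq> {}}" using M by auto
      qed
    qed (use fP in simp)
    finally show ?thesis .
  qed
  have "S \<inter> Z = (\<Union>X\<in>XS. S \<inter> X)" by (auto simp: Z_def)
  then have "card (S \<inter> Z) \<le> (\<Sum>X\<in>XS. card (S \<inter> X))" using card_UN_le[OF finXS, of "\<lambda>X. S \<inter> X"] by (simp only:)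
  also have "\<dots> \<le> (\<Sum>X\<in>XS. card {M \<in> petals1 W E. M \<subseteq> X} + 2 * card {M \<in> petals2 W E. M \<subseteq> X})"
  proof (rule sum_mono)
    fix X assume X: "X \<in> XS"
    then have "component V E X" "contains_K X E 3" by (auto simp: XS_def contains_K_def)
    then have "3 \<le> card {M \<in> petals1 W E. M \<subseteq> X} + 2 * card {M \<in> petals2 W E. M \<subseteq> X}"
      using tri by (simp add: triangles_accounted_def)
    moreover have "card (S \<inter> X) = 3" using X by (simp add: XS_def induces_K_def)
    ultimately show "card (S \<inter> X) \<le> card {M \<in> petals1 W E. M \<subseteq> X} + 2 * card {M \<in> petals2 W E. M \<subseteq> X}"
      by simp
  qed
  also have "\<dots> \<le> card PZ + 2 * card PZ2"
    unfolding sum.distrib sum_distrib_left[symmetric] PZ_def PZ2_def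
    by (intro add_mono mult_left_mono part) (auto simp: petals1_def petals2_def)
  finally have SZ: "card (S \<inter> Z) \<le> card PZ + 2 * card PZ2" .

  have part1: "M \<in> petals H E \<longleftrightarrow> M \<in> petals W E" if "M \<inter> Z \<noteq> {}" for M
    by (rule Z.petals_part[OF HV WV H(2) that])
  have part2: "M \<in> petals2 H E \<longleftrightarrow> M \<in> petals2 W E" if "M \<inter> Z \<noteq> {}" for M
    by (rule Z.petals2_part[OF HV WV H(2) that])
  have sub0: "petals H0 E \<subseteq> petals H E" "petals2 H0 E \<subseteq> petals2 H E"
    using Z'.petals_part[OF H0V HV H0eq meet0] Z'.petals2_part[OF H0V HV H0eq meet0] petals2_subset by blast+
  have dis0: "M \<inter> Z = {}" if "M \<in> petals H0 E" for M
    using petals_subset[OF that] by (auto simp: H0_def)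
  \<comment> \<open>Petals of \<open>H\<close> that meet \<open>Z\<close> are those of
    \<open>W\<close>, and the remaining ones include those of \<open>H0\<close>. A member of
    \<open>PZ\<close> counts once, among all petals; a member of \<open>PZ2\<close> counts again
    among those of Type 2.\<close>
  have "card (petals H0 E) + card (PZ \<union> PZ2) = card (petals H0 E \<union> (PZ \<union> PZ2))"
    using dis0 finPZ finite_subset[OF sub0(1) finH]
    by (intro card_Un_disjoint[symmetric]) (auto simp: PZ_def PZ2_def)
  also have "\<dots> \<le> card (petals H E)"
  proof (rule card_mono[OF finH])
    show "petals H0 E \<union> (PZ \<union> PZ2) \<subseteq> petals H E"
      using sub0 part1 petals2_subset[of W E] by (auto simp: PZ_def PZ2_def petals1_def)
  qed
  finally have c1: "card (petals H0 E) + card (PZ \<union> PZ2) \<le> card (petals H E)" .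
  have "card (petals2 H0 E) + card PZ2 = card (petals2 H0 E \<union> PZ2)"
    using dis0 petals2_subset[of H0 E] finPZ
      finite_subset[OF petals2_subset finite_subset[OF sub0(1) finH]]
    by (intro card_Un_disjoint[symmetric]) (auto simp: PZ2_def)
  also have "\<dots> \<le> card (petals2 H E)"
    using sub0 part2 finite_subset[OF petals2_subset finH] by (intro card_mono) (auto simp: PZ2_def)
  finally have c2: "card (petals2 H0 E) + card PZ2 \<le> card (petals2 H E)" .
  have c3: "card (PZ \<union> PZ2) = card PZ + card PZ2"
    using finPZ by (intro card_Un_disjoint) (auto simp: PZ_def PZ2_def petals1_def)
  have "card S = card (S \<inter> Z) + card S0"
    using card_Int_Diff[OF finS, of Z] by (simp add: S0_def)
  then have "card S \<le> card (petals H E) + card (petals2 H E)" using S0 SZ c1 c2 c3 by simp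
  moreover obtain F where F: "flower_subgraph V E F" "card (petals F E) = card (petals V E)"
    "card (petals H E) + card (petals2 H E) \<le> card (petals V E) + card (petals2 F E)"
    using convex_subgraph.ex_full_flower[of V E H] Gam G convH by (auto simp: convex_subgraph_def)
  ultimately show ?thesis using max[OF F(1,2)] by simp
qed

theorem theorem5:
  fixes V :: "'a set" and E :: "'a \<Rightarrow> 'a \<Rightarrow> bool" and W :: "'a set"
  assumes "simple_graph V E"
    and "Gamma1 V E"
    and "flower_subgraph V E W"
    and "card (petals W E) = card (petals V E)"
    and "\<And>H. \<lbrakk>flower_subgraph V E H; card (petals H E) = card (petals V E)\<rbrakk>
           \<Longrightarrow> card (petals2 H E) \<le> card (petals2 W E)"
    and "triangles_accounted V E W"
  shows "monophonic_rank V E = card (petals1 W E) + 2 * card (petals2 W E)"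
proof -
  have WV: "W \<subseteq> V" by (rule flower_subset[OF assms(3)])
  have finV: "finite V" by (rule simple_graph_finite[OF assms(1)])
  have finW: "finite (petals W E)" using finV WV by (intro finite_petals) (rule finite_subset)
  \<comment> \<open>The claimed value is the number of petals plus the number of those of Type 2,
    the form in which both bounds are stated.\<close>
  have "card (petals1 W E) = card (petals W E) - card (petals2 W E)"
    unfolding petals1_def using finite_subset[OF petals2_subset finW] petals2_subset by (rule card_Diff_subset)
  moreover have "card (petals2 W E) \<le> card (petals W E)" using finW petals2_subset by (rule card_mono)
  ultimately have val: "card (petals1 W E) + 2 * card (petals2 W E) = card (petals W E) + card (petals2 W E)"
    by simp
  show ?thesis
    unfolding monophonic_rank_def val
  proof (rule Max_eqI)
    have "{card S |S. monophonically_independent V E S} \<subseteq> card ` Pow V"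
      by (auto simp: monophonically_independent_def)
    then show "finite {card S |S. monophonically_independent V E S}"
      by (rule finite_subset) (use finV in simp)
    show "n \<le> card (petals W E) + card (petals2 W E)"
      if "n \<in> {card S |S. monophonically_independent V E S}" for n
      using that independent_card_bound[OF assms(1,2,3,5,6)] assms(4) by auto
    \<comment> \<open>The bound is attained by stamen sets chosen in \<open>W\<close>; they stay
      independent in \<open>V\<close> because \<open>W\<close> is convex.\<close>
    obtain S where S: "monophonically_independent W E S" "card S = card (petals W E) + card (petals2 W E)"
      using ex_stamens[OF simple_graph_subset[OF assms(1) WV]] by blast
    have "monophonically_independent V E S"
      by (rule independent_super[OF S(1) flower_convex[OF assms(1,3)]])
    then show "card (petals W E) + card (petals2 W E) \<in> {card S |S. monophonically_independent V E S}"
      using S(2) by force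
  qed
qed

end
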